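(* Consider the Cauchy problem $$u_{tt}-\Delta u+b(t)u_t-g(t)\Delta u_t=0,\quad (t,x)\in[0,\infty)\times\mathbb{R}^n,\qquad u(0,x)=u_0(x),\quad u_t(0,x)=u_1(x),\quad x\in\mathbb{R}^n,$$ with $b(t)=e^t$ and $g(t)=\frac12e^{-e^t}$. Then there is a (sufficiently large) $t_0$ such that for all $t\ge t_0$ Sobolev solutions satisfy $$\||D|^{|\beta|}u(t,\cdot)\|_{L^2}\lesssim\|u_0\|_{H^{|\beta|}}+\|u_1\|_{H^{|\beta|-1}}\quad\text{for }|\beta|\ge1,$$ $$\||D|^{|\beta|}u_t(t,\cdot)\|_{L^2}\lesssim\|u_0\|_{H^{|\beta|+1}}+\|u_1\|_{H^{|\beta|}}\quad\text{for }|\beta|\ge0.$$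
   Context: $f\lesssim h$ means $f\le Ch$ with a constant $C>0$ independent of $t$ and of the data. $|D|^a$ is the Fourier multiplier with symbol $|\xi|^a$; $H^a=H^a(\mathbb{R}^n)$ is the Bessel potential (inhomogeneous Sobolev) space based on $L^2$. $|\beta|$ denotes the order of differentiation (a number). Each estimate is understood for data for which its right-hand side is finite. Sobolev solutions are understood via the partial Fourier transform in $x$: $\hat u(t,\xi)$ solves $\hat u_{tt}+|\xi|^2\hat u+(b(t)+g(t)|\xi|^2)\hat u_t=0$, $\hat u(0,\xi)=\hat u_0(\xi)$, $\hat u_t(0,\xi)=\hat u_1(\xi)$. *)

theory Defs
  imports "HOL-Analysis.Analysis"
begin

text \<open>Elements of function spaces are Borel measurable representatives; every
  Lebesgue measurable function agrees almost everywhere with such a function.\<close>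

definition L2 :: "('a::euclidean_space \<Rightarrow> complex) set" where
  "L2 = {f \<in> borel_measurable lborel. integrable lborel (\<lambda>x. (cmod (f x))\<^sup>2)}"

definition L2_norm :: "('a::euclidean_space \<Rightarrow> complex) \<Rightarrow> real" where
  "L2_norm f = sqrt (\<integral>x. (cmod (f x))\<^sup>2 \<partial>lborel)"

definition fourier_integral :: "('a::euclidean_space \<Rightarrow> complex) \<Rightarrow> 'a \<Rightarrow> complex" where
  "fourier_integral f \<xi> =
     of_real ((2 * pi) powr (- real DIM('a) / 2)) * (\<integral>x. cis (- (x \<bullet> \<xi>)) * f x \<partial>lborel)"

text \<open>The Fourier--Plancherel transform: the Fourier integral need not converge for
  \<open>f \<in> L2\<close>, so the transform is the \<open>L2\<close>-limit of the Fourier integrals of the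
  truncations of \<open>f\<close> to balls (which are integrable). The limit is stated with the
  nonnegative integral, which does not default to \<open>0\<close> for non-integrable functions.\<close>

definition has_L2_fourier ::
    "('a::euclidean_space \<Rightarrow> complex) \<Rightarrow> ('a \<Rightarrow> complex) \<Rightarrow> bool" where
  "has_L2_fourier f F \<longleftrightarrow> f \<in> L2 \<and> F \<in> L2 \<and>
     ((\<lambda>R::real. \<integral>\<^sup>+\<xi>. ennreal ((cmod (F \<xi>
          - fourier_integral (\<lambda>x. indicator (ball 0 R) x * f x) \<xi>))\<^sup>2) \<partial>lborel)
        \<longlongrightarrow> 0) at_top"

text \<open>Some representative; the transform is determined only almost everywhere.\<close>

definition L2_fourier :: "('a::euclidean_space \<Rightarrow> complex) \<Rightarrow> 'a \<Rightarrow> complex" where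
  "L2_fourier f = (SOME F. has_L2_fourier f F)"

text \<open>Bessel potential spaces. Only orders \<open>s \<ge> 0\<close> are meant, for which the tempered
  distributions in \<open>H\<^sup>s\<close> are \<open>L2\<close>-functions.\<close>

definition sobolev_space :: "real \<Rightarrow> ('a::euclidean_space \<Rightarrow> complex) set" where
  "sobolev_space s =
     {f \<in> L2. (\<lambda>\<xi>. of_real ((1 + (norm \<xi>)\<^sup>2) powr (s / 2)) * L2_fourier f \<xi>) \<in> L2}"

definition sobolev_norm :: "real \<Rightarrow> ('a::euclidean_space \<Rightarrow> complex) \<Rightarrow> real" where
  "sobolev_norm s f =
     L2_norm (\<lambda>\<xi>. of_real ((1 + (norm \<xi>)\<^sup>2) powr (s / 2)) * L2_fourier f \<xi>)"

text \<open>\<open>has_abs_D a f w\<close>: the function \<open>w\<close> is \<open>|D|\<^sup>a f\<close>, and it lies in \<open>L2\<close>. It is stated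
  as a relation because the multiplier is unbounded on \<open>L2\<close>; \<open>w\<close> is unique almost
  everywhere. (The value \<open>0 powr 0 = 0\<close> only affects the null set \<open>{0}\<close>.)\<close>

definition has_abs_D ::
    "real \<Rightarrow> ('a::euclidean_space \<Rightarrow> complex) \<Rightarrow> ('a \<Rightarrow> complex) \<Rightarrow> bool" where
  "has_abs_D a f w \<longleftrightarrow> f \<in> L2 \<and> w \<in> L2 \<and>
     (AE \<xi> in lborel. L2_fourier w \<xi> = of_real (norm \<xi> powr a) * L2_fourier f \<xi>)"

text \<open>Sobolev solutions \<open>u\<close>, with time derivative \<open>ut\<close>, of
  \<open>u\<^sub>t\<^sub>t - \<Delta>u + b(t) u\<^sub>t - g(t) \<Delta>u\<^sub>t = 0\<close>, \<open>u(0) = u0\<close>, \<open>u\<^sub>t(0) = u1\<close>, understood via the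
  partial Fourier transform in \<open>x\<close>. The transform at each time is determined only up to a
  null set, so a joint representative \<open>v\<close> is required that solves the ordinary
  differential equation in \<open>t\<close> for almost every frequency.\<close>

definition sobolev_solution ::
    "(real \<Rightarrow> real) \<Rightarrow> (real \<Rightarrow> real) \<Rightarrow> ('a::euclidean_space \<Rightarrow> complex) \<Rightarrow> ('a \<Rightarrow> complex)
      \<Rightarrow> (real \<Rightarrow> 'a \<Rightarrow> complex) \<Rightarrow> (real \<Rightarrow> 'a \<Rightarrow> complex) \<Rightarrow> bool" where
  "sobolev_solution b g u0 u1 u ut \<longleftrightarrow>
     u0 \<in> L2 \<and> u1 \<in> L2 \<and> (\<forall>t\<ge>0. u t \<in> L2 \<and> ut t \<in> L2) \<and>
     (\<exists>v v' v''.
        (\<forall>t\<ge>0. (AE \<xi> in lborel. v t \<xi> = L2_fourier (u t) \<xi>) \<and>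
               (AE \<xi> in lborel. v' t \<xi> = L2_fourier (ut t) \<xi>)) \<and>
        (AE \<xi> in lborel.
           v 0 \<xi> = L2_fourier u0 \<xi> \<and> v' 0 \<xi> = L2_fourier u1 \<xi> \<and>
           (\<forall>t\<ge>0.
              ((\<lambda>s. v s \<xi>) has_vector_derivative v' t \<xi>) (at t within {0..}) \<and>
              ((\<lambda>s. v' s \<xi>) has_vector_derivative v'' t \<xi>) (at t within {0..}) \<and>
              v'' t \<xi> + of_real ((norm \<xi>)\<^sup>2) * v t \<xi>
                + of_real (b t + g t * (norm \<xi>)\<^sup>2) * v' t \<xi> = 0)))"

end

theory Submission
  imports Defs "HOL-Probability.Characteristic_Functions"
begin

text \<open>
  The estimates are energy estimates for single frequencies. For fixed \<open>\<xi>\<close>, with \<open>r = |\<xi>|\<close>, the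
  transformed equation is the oscillator \<open>v'' + r\<^sup>2 v + d(t) v' = 0\<close> with damping
  \<open>d(t) = b(t) + g(t) r\<^sup>2 \<ge> 0\<close>. Its energy \<open>|v'|\<^sup>2 + r\<^sup>2 |v|\<^sup>2\<close> has derivative \<open>- 2 d |v'|\<^sup>2 \<le> 0\<close>, so
  both \<open>r |v(t)|\<close> and \<open>|v'(t)|\<close> stay below \<open>r |v(0)| + |v'(0)|\<close> from time \<open>0\<close> on. Multiplying by
  \<open>r\<^sup>s\<close> with \<open>s \<ge> 0\<close> and replacing powers of \<open>r\<close> by powers of \<open>(1 + r\<^sup>2)\<^sup>1\<^sup>/\<^sup>2\<close> gives the pointwise
  form of both estimates (\<open>s = |\<beta>| - 1\<close> for \<open>u\<close>, \<open>s = |\<beta>|\<close> for \<open>u\<^sub>t\<close>), and integrating the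
  squares over \<open>\<xi>\<close> gives the bounds with \<open>t\<^sub>0 = 0\<close> and \<open>C = 2\<close>; these are the lemmas
  \<open>damped_oscillator_bounds\<close>, \<open>homogeneous_le_bessel_weights\<close> and
  \<open>sobolev_solution_estimate\<close>.

  The function \<open>|D|\<^sup>a u(t)\<close> itself has to be produced from its Fourier transform, and the chosen
  transform of an \<open>L\<^sup>2\<close> function has to exist. So the larger part of the proof is a one-sided
  form of Plancherel's theorem: every \<open>f\<close> in \<open>L\<^sup>2\<close> has a transform, unique almost everywhere, of
  norm at most that of \<open>f\<close> (\<open>has_L2_fourier_exists\<close>, \<open>has_L2_fourier_unique\<close>), and every \<open>F\<close> in
  \<open>L\<^sup>2\<close> is the transform of some \<open>w\<close> of norm at most that of \<open>F\<close> (\<open>has_L2_fourier_surj\<close>).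

  Everything there rests on one identity. Inserting the factor \<open>exp (- d\<^sup>2 |\<xi>|\<^sup>2 / 2)\<close> in
  \<open>\<integral> Ff \<cdot> cnj (Fh)\<close> makes Fubini's theorem applicable, and the result is \<open>\<integral> f \<cdot> cnj (h\<^sub>d)\<close>, where
  \<open>h\<^sub>d(x)\<close> is the mean of \<open>h(x + d z)\<close> over a standard Gaussian \<open>z\<close> (\<open>parseval_regularized\<close>).
  For \<open>h = f\<close> the arithmetic-geometric mean inequality bounds the right-hand side by \<open>\<integral> |f|\<^sup>2\<close>
  for every \<open>d\<close>, and Fatou's lemma gives the contraction property on integrable functions
  (\<open>fourier_integral_contraction\<close>); it extends the transform to \<open>L\<^sup>2\<close>. For \<open>h\<close> the indicator of
  a box, dominated convergence as \<open>d \<rightarrow> 0\<close> gives Parseval's identity (\<open>parseval_box\<close>). The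
  candidate inverse of \<open>F\<close> is the transform \<open>w\<close> of \<open>\<xi> \<mapsto> F(- \<xi>)\<close>; by \<open>parseval_box\<close> the transform
  of \<open>w\<close> has the same integral as \<open>F\<close> over every box, hence equals \<open>F\<close> almost everywhere.
\<close>


section \<open>Gaussians in Euclidean space\<close>

lemma borel_measurable_cis [measurable]: "cis \<in> borel_measurable borel"
  by (intro borel_measurable_continuous_onI continuous_intros)

definition gauss :: "'a::euclidean_space \<Rightarrow> real" where
  "gauss z = (2 * pi) powr (- real DIM('a) / 2) * exp (- (norm z)\<^sup>2 / 2)"

text \<open>The factorization over coordinates reduces integrals of the Gaussian to one dimension.\<close>

lemma gauss_eq_prod: "gauss z = (\<Prod>b\<in>Basis. std_normal_density (z \<bullet> b))"
proof -
  have "(\<Prod>b\<in>Basis. std_normal_density (z \<bullet> b))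
      = (1 / sqrt (2 * pi)) ^ DIM('a) * exp (\<Sum>b\<in>(Basis::'a set). - (z \<bullet> b)\<^sup>2 / 2)"
    by (simp add: std_normal_density_def prod_dividef exp_sum prod.distrib power_divide)
  also have "(\<Sum>b\<in>(Basis::'a set). - (z \<bullet> b)\<^sup>2 / 2) = - (norm z)\<^sup>2 / 2"
    by (simp add: norm_eq_sqrt_inner euclidean_inner[of z z] power2_eq_square sum_negf sum_divide_distrib sum_nonneg)
  also have "(1 / sqrt (2 * pi)) ^ DIM('a) = (2 * pi) powr (- real DIM('a) / 2)"
  proof -
    have "1 / sqrt (2 * pi) = (2 * pi) powr (- 1 / 2)"
      using powr_minus_divide[of "2 * pi" "1 / 2"] by (simp add: powr_half_sqrt)
    then show ?thesis by (simp add: powr_power)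
  qed
  finally show ?thesis by (simp add: gauss_def)
qed

lemma borel_measurable_gauss [measurable]: "gauss \<in> borel_measurable borel"
  unfolding gauss_def by measurable

lemma gauss_nonneg: "gauss z \<ge> 0"
  by (simp add: gauss_def)

text \<open>Lebesgue measure is a product measure up to the isomorphism that sends a family of
  coordinates to the vector with these coordinates.\<close>

lemma lborel_integral_prod:
  fixes f :: "'a::euclidean_space \<Rightarrow> real \<Rightarrow> complex"
  assumes "\<And>b. b \<in> Basis \<Longrightarrow> integrable lborel (f b)"
  shows "integrable lborel (\<lambda>x::'a. \<Prod>b\<in>Basis. f b (x \<bullet> b))"
    and "(\<integral>x. (\<Prod>b\<in>Basis. f b (x \<bullet> b)) \<partial>lborel) = (\<Prod>b\<in>Basis. \<integral>x. f b x \<partial>lborel)"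
proof -
  interpret product_sigma_finite "\<lambda>_::'a. lborel :: real measure" by standard
  have [measurable]: "f b \<in> borel_measurable borel" if "b \<in> Basis" for b
    using assms[OF that] by auto
  have m: "(\<lambda>x::'a. \<Prod>b\<in>Basis. f b (x \<bullet> b)) \<in> borel_measurable borel"
    by measurable
  have e: "(\<Prod>b\<in>Basis. f b ((\<Sum>c\<in>Basis. x c *\<^sub>R c) \<bullet> b)) = (\<Prod>b\<in>Basis. f b (x b))" for x
    by (intro prod.cong) auto
  show "integrable lborel (\<lambda>x::'a. \<Prod>b\<in>Basis. f b (x \<bullet> b))"
    using product_integrable_prod[OF finite_Basis assms] m
    by (subst lborel_eq, subst integrable_distr_eq) (auto simp: e)
  show "(\<integral>x. (\<Prod>b\<in>Basis. f b (x \<bullet> b)) \<partial>lborel) = (\<Prod>b\<in>Basis. \<integral>x. f b x \<partial>lborel)"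
    using product_integral_prod[OF finite_Basis assms] m
    by (subst lborel_eq, subst integral_distr) (auto simp: e)
qed

lemma std_normal_density_fourier:
  shows "integrable lborel (\<lambda>x. cis (s * x) * of_real (std_normal_density x))"
    and "(\<integral>x. cis (s * x) * of_real (std_normal_density x) \<partial>lborel) = of_real (exp (- s\<^sup>2 / 2))"
proof -
  have "integrable lborel (\<lambda>x. complex_of_real (std_normal_density x))"
    by (intro integrable_of_real) simp
  then show "integrable lborel (\<lambda>x. cis (s * x) * of_real (std_normal_density x))"
    by (rule Bochner_Integration.integrable_bound) (auto simp: norm_mult cis_conv_exp)
  have "char std_normal_distribution s = of_real (exp (- s\<^sup>2 / 2))"
    by (simp add: char_std_normal_distribution)
  then show "(\<integral>x. cis (s * x) * of_real (std_normal_density x) \<partial>lborel) = of_real (exp (- s\<^sup>2 / 2))"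
    unfolding char_def by (subst (asm) integral_density)
      (auto simp: cis_conv_exp mult.commute scaleR_conv_of_real normal_density_nonneg)
qed

lemma gauss_characteristic_function:
  fixes s :: "'a::euclidean_space"
  shows "integrable lborel (\<lambda>x. cis (s \<bullet> x) * of_real (gauss x))"
    and "(\<integral>x. cis (s \<bullet> x) * of_real (gauss x) \<partial>lborel) = of_real (exp (- (norm s)\<^sup>2 / 2))"
proof -
  have cs: "cis (sum g (Basis::'a set)) = (\<Prod>b\<in>Basis. cis (g b))" for g
    by (simp add: cis_conv_exp sum_distrib_left exp_sum)
  have e: "cis (s \<bullet> x) * of_real (gauss x)
     = (\<Prod>b\<in>Basis. cis ((s \<bullet> b) * (x \<bullet> b)) * of_real (std_normal_density (x \<bullet> b)))" for x
    by (simp add: euclidean_inner[of s x] cs gauss_eq_prod prod.distrib)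
  show "integrable lborel (\<lambda>x. cis (s \<bullet> x) * of_real (gauss x))"
    unfolding e by (rule lborel_integral_prod) (rule std_normal_density_fourier)
  have "(\<integral>x. cis (s \<bullet> x) * of_real (gauss x) \<partial>lborel) = (\<Prod>b\<in>Basis. of_real (exp (- (s \<bullet> b)\<^sup>2 / 2)))"
    unfolding e by (subst lborel_integral_prod) (auto intro: std_normal_density_fourier simp: std_normal_density_fourier(2))
  also have "\<dots> = of_real (exp (\<Sum>b\<in>Basis. - (s \<bullet> b)\<^sup>2 / 2))"
    by (simp add: exp_sum)
  also have "(\<Sum>b\<in>Basis. - (s \<bullet> b)\<^sup>2 / 2) = - (norm s)\<^sup>2 / 2"
    by (simp add: norm_eq_sqrt_inner euclidean_inner[of s s] power2_eq_square sum_negf sum_divide_distrib sum_nonneg)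
  finally show "(\<integral>x. cis (s \<bullet> x) * of_real (gauss x) \<partial>lborel) = of_real (exp (- (norm s)\<^sup>2 / 2))" .
qed

lemma gauss_integrable: "integrable lborel (gauss :: 'a::euclidean_space \<Rightarrow> real)"
proof -
  have "integrable lborel (\<lambda>x::'a. norm (cis (0 \<bullet> x) * of_real (gauss x)))"
    by (intro integrable_norm gauss_characteristic_function)
  then show ?thesis by (simp add: norm_mult gauss_nonneg)
qed

lemma gauss_integral: "(\<integral>x. gauss x \<partial>lborel) = 1"
proof -
  have "complex_of_real (\<integral>x. gauss (x::'a) \<partial>lborel) = 1"
    using gauss_characteristic_function(2)[of "0::'a"] by simp
  then show ?thesis by simp
qed

lemma nn_integral_gauss: "(\<integral>\<^sup>+x. ennreal (gauss x) \<partial>lborel) = 1"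
  by (simp add: nn_integral_eq_integral gauss_integrable gauss_nonneg gauss_integral)

text \<open>This and its analogue for nonnegative integrals cover translations (\<open>c = 1\<close>), the reflection
  (\<open>c = - 1\<close>, \<open>t = 0\<close>) and the scaling of Gaussians.\<close>

lemma lborel_integral_affine:
  fixes f :: "'a::euclidean_space \<Rightarrow> 'b::{banach, second_countable_topology}"
  assumes [measurable]: "f \<in> borel_measurable borel" and c: "c \<noteq> 0"
  shows "integrable lborel (\<lambda>x. f (t + c *\<^sub>R x)) \<longleftrightarrow> integrable lborel f"
    and "(\<integral>x. f x \<partial>lborel) = \<bar>c\<bar> ^ DIM('a) *\<^sub>R (\<integral>x. f (t + c *\<^sub>R x) \<partial>lborel)"
proof -
  show "integrable lborel (\<lambda>x. f (t + c *\<^sub>R x)) \<longleftrightarrow> integrable lborel f"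
  proof -
    have "integrable lborel f \<longleftrightarrow> integrable lborel (\<lambda>x. \<bar>c\<bar> ^ DIM('a) *\<^sub>R f (t + c *\<^sub>R x))"
      by (subst lborel_affine[OF c, of t]) (simp add: integrable_density integrable_distr_eq)
    also have "\<dots> \<longleftrightarrow> integrable lborel (\<lambda>x. f (t + c *\<^sub>R x))"
      using c integrable_scaleR_right[of "inverse (\<bar>c\<bar> ^ DIM('a))" lborel
        "\<lambda>x. \<bar>c\<bar> ^ DIM('a) *\<^sub>R f (t + c *\<^sub>R x)"] by auto
    finally show ?thesis by simp
  qed
  show "(\<integral>x. f x \<partial>lborel) = \<bar>c\<bar> ^ DIM('a) *\<^sub>R (\<integral>x. f (t + c *\<^sub>R x) \<partial>lborel)"
    by (subst lborel_affine[OF c, of t]) (simp add: integral_density integral_distr)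
qed

lemma lborel_nn_integral_affine:
  fixes f :: "'a::euclidean_space \<Rightarrow> ennreal"
  assumes [measurable]: "f \<in> borel_measurable borel" and c: "c \<noteq> 0"
  shows "(\<integral>\<^sup>+x. f x \<partial>lborel) = ennreal (\<bar>c\<bar> ^ DIM('a)) * (\<integral>\<^sup>+x. f (t + c *\<^sub>R x) \<partial>lborel)"
    by (subst lborel_affine[OF c, of t]) (simp add: nn_integral_density nn_integral_distr nn_integral_cmult)

text \<open>This equals \<open>1\<close> at \<open>d = 0\<close>; for \<open>d > 0\<close> its product with a bounded measurable function
  is integrable, and its Fourier transform is a positive Gaussian.\<close>

definition gauss_cutoff :: "real \<Rightarrow> 'a::euclidean_space \<Rightarrow> real" where
  "gauss_cutoff d \<xi> = exp (- (d * norm \<xi>)\<^sup>2 / 2)"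

lemma gauss_cutoff_measurable [measurable]: "gauss_cutoff d \<in> borel_measurable borel"
  unfolding gauss_cutoff_def by measurable

lemma gauss_cutoff_fourier:
  fixes a :: "'a::euclidean_space"
  assumes d: "d > 0"
  shows "integrable lborel (gauss_cutoff d :: 'a \<Rightarrow> real)"
    and "(\<integral>x. cis (a \<bullet> x) * of_real (gauss_cutoff d x) \<partial>lborel)
       = of_real ((2 * pi) powr (real DIM('a) / 2) / d ^ DIM('a) * exp (- (norm (a /\<^sub>R d))\<^sup>2 / 2))"
proof -
  let ?K = "(2 * pi) powr (real DIM('a) / 2)"
  have g: "gauss_cutoff d x = ?K * gauss (0 + d *\<^sub>R x)" for x :: 'a
    using d by (simp add: gauss_cutoff_def gauss_def powr_minus)
  show "integrable lborel (gauss_cutoff d :: 'a \<Rightarrow> real)"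
    unfolding g[abs_def] using d
    by (intro integrable_mult_right) (subst lborel_integral_affine, auto simp: gauss_integrable)
  have "of_real (exp (- (norm (a /\<^sub>R d))\<^sup>2 / 2)) = (\<integral>x. cis ((a /\<^sub>R d) \<bullet> x) * complex_of_real (gauss x) \<partial>lborel)"
    by (rule gauss_characteristic_function(2)[symmetric])
  also have "\<dots> = d ^ DIM('a) *\<^sub>R (\<integral>x. cis ((a /\<^sub>R d) \<bullet> (0 + d *\<^sub>R x)) * complex_of_real (gauss (0 + d *\<^sub>R x)) \<partial>lborel)"
    using d by (subst lborel_integral_affine(2)[where c=d and t=0]) auto
  also have "\<dots> = d ^ DIM('a) *\<^sub>R (\<integral>x. cis (a \<bullet> x) * complex_of_real (gauss (0 + d *\<^sub>R x)) \<partial>lborel)"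
    using d by (simp add: mult.assoc[symmetric])
  finally have *: "of_real (exp (- (norm (a /\<^sub>R d))\<^sup>2 / 2)) = d ^ DIM('a) *\<^sub>R (\<integral>x. cis (a \<bullet> x) * complex_of_real (gauss (0 + d *\<^sub>R x)) \<partial>lborel)" .
  have "(\<integral>x. cis (a \<bullet> x) * complex_of_real (gauss_cutoff d x) \<partial>lborel) =
     of_real ?K * (\<integral>x. cis (a \<bullet> x) * complex_of_real (gauss (0 + d *\<^sub>R x)) \<partial>lborel)"
    unfolding g of_real_mult mult.left_commute[of "cis _" "of_real ?K"] by (rule integral_mult_right_zero)
  also have "\<dots> = of_real (?K / d ^ DIM('a)) * of_real (exp (- (norm (a /\<^sub>R d))\<^sup>2 / 2))"
    unfolding * using d by (simp add: scaleR_conv_of_real)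
  finally show "(\<integral>x. cis (a \<bullet> x) * complex_of_real (gauss_cutoff d x) \<partial>lborel)
       = of_real (?K / d ^ DIM('a) * exp (- (norm (a /\<^sub>R d))\<^sup>2 / 2))" by simp
qed

section \<open>The regularized Parseval identity\<close>

text \<open>The integrability needed for Fubini in double integrals whose kernel has modulus \<open>1\<close>.\<close>

lemma integrable_tensor:
  fixes f :: "'a::euclidean_space \<Rightarrow> complex" and h :: "'b::euclidean_space \<Rightarrow> complex"
    and k :: "'a \<times> 'b \<Rightarrow> complex"
  assumes f: "integrable lborel f" and h: "integrable lborel h"
    and k [measurable]: "k \<in> borel_measurable borel" and k1: "\<And>p. norm (k p) = 1"
  shows "integrable (lborel \<Otimes>\<^sub>M lborel) (\<lambda>(x, y). k (x, y) * (f x * h y))"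
proof -
  have [measurable]: "f \<in> borel_measurable borel" "h \<in> borel_measurable borel"
    using f h by auto
  have k' [measurable]: "k \<in> borel_measurable (borel \<Otimes>\<^sub>M borel)"
    using k by (simp add: borel_prod)
  show ?thesis
  proof (rule lborel_pair.Fubini_integrable)
    show "(\<lambda>(x, y). k (x, y) * (f x * h y)) \<in> borel_measurable (lborel \<Otimes>\<^sub>M lborel)"
      by measurable
    have "integrable lborel (\<lambda>x. norm (f x) * (\<integral>y. norm (h y) \<partial>lborel))"
      using f by simp
    then show "integrable lborel (\<lambda>x. \<integral>y. norm (case (x, y) of (x, y) \<Rightarrow> k (x, y) * (f x * h y)) \<partial>lborel)"
      by (simp add: norm_mult k1)
    show "AE x in lborel. integrable lborel (\<lambda>y. case (x, y) of (x, y) \<Rightarrow> k (x, y) * (f x * h y))"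
    proof (rule AE_I2)
      fix x
      have "integrable lborel (\<lambda>y. f x * h y)" using h by simp
      then show "integrable lborel (\<lambda>y. case (x, y) of (x, y) \<Rightarrow> k (x, y) * (f x * h y))"
        by (rule Bochner_Integration.integrable_bound) (auto simp: norm_mult k1)
    qed
  qed
qed

lemma borel_measurable_cnj_compose [measurable (raw)]:
  "f \<in> borel_measurable M \<Longrightarrow> (\<lambda>x. cnj (f x)) \<in> borel_measurable M"
  by (rule measurable_compose, assumption)
    (intro borel_measurable_continuous_onI continuous_intros)

lemma integrable_unimodular:
  assumes "integrable M f" "k \<in> borel_measurable M" "\<And>x. norm (k x) = 1"
  shows "integrable M (\<lambda>x. k x * f x :: complex)"
  using assms(1) by (rule Bochner_Integration.integrable_bound)
    (use assms in \<open>auto simp: norm_mult\<close>)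

lemma fourier_integral_measurable [measurable]:
  assumes [measurable]: "f \<in> borel_measurable borel"
  shows "fourier_integral f \<in> borel_measurable borel"
  unfolding fourier_integral_def by measurable

lemma fourier_integral_bound:
  fixes f :: "'a::euclidean_space \<Rightarrow> complex"
  shows "cmod (fourier_integral f \<xi>) \<le> (2 * pi) powr (- real DIM('a) / 2) * (\<integral>x. cmod (f x) \<partial>lborel)"
proof -
  have "cmod (\<integral>x. cis (- (x \<bullet> \<xi>)) * f x \<partial>lborel) \<le> (\<integral>x. cmod (cis (- (x \<bullet> \<xi>)) * f x) \<partial>lborel)"
    by (rule integral_norm_bound)
  then show ?thesis
    by (simp add: fourier_integral_def norm_mult mult_left_mono)
qed

text \<open>Both sides are the same double integral, since the kernel is symmetric in \<open>x\<close> and \<open>\<xi>\<close>.\<close>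

lemma fourier_integral_multiplication_formula:
  fixes f h :: "'a::euclidean_space \<Rightarrow> complex"
  assumes f: "integrable lborel f" and h: "integrable lborel h"
  shows "(\<integral>\<xi>. fourier_integral f \<xi> * h \<xi> \<partial>lborel) = (\<integral>x. f x * fourier_integral h x \<partial>lborel)"
proof -
  let ?c = "complex_of_real ((2 * pi) powr (- real DIM('a) / 2))"
  have "integrable (lborel \<Otimes>\<^sub>M lborel) (\<lambda>(x, \<xi>). cis (- (x \<bullet> \<xi>)) * (f x * h \<xi>))"
    using integrable_tensor[OF f h, of "\<lambda>p. cis (- (fst p \<bullet> snd p))"] by (simp add: borel_prod[symmetric])
  from lborel_pair.Fubini_integral[OF this]
  have "(\<integral>\<xi>. \<integral>x. cis (- (x \<bullet> \<xi>)) * (f x * h \<xi>) \<partial>lborel \<partial>lborel) =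
        (\<integral>x. \<integral>\<xi>. cis (- (x \<bullet> \<xi>)) * (f x * h \<xi>) \<partial>lborel \<partial>lborel)" .
  moreover have "(\<integral>x. cis (- (x \<bullet> \<xi>)) * (f x * h \<xi>) \<partial>lborel) = h \<xi> * (\<integral>x. cis (- (x \<bullet> \<xi>)) * f x \<partial>lborel)" for \<xi>
    unfolding integral_mult_right_zero[symmetric] by (simp add: mult_ac)
  moreover have "(\<integral>\<xi>. cis (- (x \<bullet> \<xi>)) * (f x * h \<xi>) \<partial>lborel) = f x * (\<integral>\<xi>. cis (- (\<xi> \<bullet> x)) * h \<xi> \<partial>lborel)" for x
    unfolding integral_mult_right_zero[symmetric] by (simp add: mult_ac inner_commute)
  ultimately have "(\<integral>\<xi>. ?c * (h \<xi> * (\<integral>x. cis (- (x \<bullet> \<xi>)) * f x \<partial>lborel)) \<partial>lborel)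
      = (\<integral>x. ?c * (f x * (\<integral>\<xi>. cis (- (\<xi> \<bullet> x)) * h \<xi> \<partial>lborel)) \<partial>lborel)"
    by simp
  then show ?thesis
    by (simp add: fourier_integral_def mult_ac)
qed

text \<open>The convolution of \<open>f\<close> with the Gaussian of standard deviation \<open>d\<close>, written after the
  substitution \<open>y = x + d z\<close>: the weight then does not depend on \<open>d\<close>, so that \<open>d \<rightarrow> 0\<close> can be
  taken by dominated convergence.\<close>

definition gauss_mean :: "real \<Rightarrow> ('a::euclidean_space \<Rightarrow> complex) \<Rightarrow> 'a \<Rightarrow> complex" where
  "gauss_mean d f x = (\<integral>z. of_real (gauss z) * f (x + d *\<^sub>R z) \<partial>lborel)"

text \<open>Fourier inversion with the frequency cutoff inserted: the multiplication formula moves the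
  transform from \<open>f\<close> to the modulated cutoff, whose transform is a Gaussian centred at \<open>x\<close>.\<close>

lemma fourier_integral_gauss_mean:
  fixes f :: "'a::euclidean_space \<Rightarrow> complex"
  assumes f: "integrable lborel f" and d: "d > 0"
  shows "of_real ((2 * pi) powr (- real DIM('a) / 2))
      * (\<integral>\<xi>. cis (x \<bullet> \<xi>) * of_real (gauss_cutoff d \<xi>) * fourier_integral f \<xi> \<partial>lborel) = gauss_mean d f x"
proof -
  let ?c = "(2 * pi) powr (- real DIM('a) / 2)"
  have [measurable]: "f \<in> borel_measurable borel" using f by auto
  let ?h = "\<lambda>\<xi>. cis (x \<bullet> \<xi>) * complex_of_real (gauss_cutoff d \<xi>)"
  have h: "integrable lborel ?h"
    by (rule integrable_unimodular)
      (auto intro: integrable_of_real gauss_cutoff_fourier(1)[OF d])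
  have Fh: "fourier_integral ?h y = of_real (exp (- (norm ((x - y) /\<^sub>R d))\<^sup>2 / 2) / d ^ DIM('a))" for y
  proof -
    have "fourier_integral ?h y = of_real ?c * (\<integral>\<xi>. cis ((x - y) \<bullet> \<xi>) * complex_of_real (gauss_cutoff d \<xi>) \<partial>lborel)"
      unfolding fourier_integral_def
      by (simp add: mult.assoc[symmetric] cis_mult inner_diff_left inner_commute[of _ y])
    also have "\<dots> = of_real (?c * ((2 * pi) powr (real DIM('a) / 2) / d ^ DIM('a) * exp (- (norm ((x - y) /\<^sub>R d))\<^sup>2 / 2)))"
      by (subst gauss_cutoff_fourier(2)[OF d]) simp
    also have "?c * ((2 * pi) powr (real DIM('a) / 2) / d ^ DIM('a) * exp (- (norm ((x - y) /\<^sub>R d))\<^sup>2 / 2))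
       = exp (- (norm ((x - y) /\<^sub>R d))\<^sup>2 / 2) / d ^ DIM('a)"
      by (simp add: powr_minus)
    finally show ?thesis .
  qed
  have "(\<integral>\<xi>. ?h \<xi> * fourier_integral f \<xi> \<partial>lborel) = (\<integral>y. f y * fourier_integral ?h y \<partial>lborel)"
    using fourier_integral_multiplication_formula[OF f h] by (simp add: mult.commute)
  also have "\<dots> = (\<integral>y. f y * of_real (exp (- (norm ((x - y) /\<^sub>R d))\<^sup>2 / 2) / d ^ DIM('a)) \<partial>lborel)"
    by (simp only: Fh)
  also have "\<dots> = \<bar>d\<bar> ^ DIM('a) *\<^sub>R (\<integral>z. f (x + d *\<^sub>R z) * of_real (exp (- (norm ((x - (x + d *\<^sub>R z)) /\<^sub>R d))\<^sup>2 / 2) / d ^ DIM('a)) \<partial>lborel)"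
    using d by (intro lborel_integral_affine(2)) auto
  also have "\<dots> = (\<integral>z. \<bar>d\<bar> ^ DIM('a) *\<^sub>R (f (x + d *\<^sub>R z) * of_real (exp (- (norm ((x - (x + d *\<^sub>R z)) /\<^sub>R d))\<^sup>2 / 2) / d ^ DIM('a))) \<partial>lborel)"
    by simp
  also have "\<dots> = (\<integral>z. f (x + d *\<^sub>R z) * of_real (exp (- (norm z)\<^sup>2 / 2)) \<partial>lborel)"
    using d by (intro Bochner_Integration.integral_cong) (auto simp: scaleR_conv_of_real)
  finally have *: "(\<integral>\<xi>. ?h \<xi> * fourier_integral f \<xi> \<partial>lborel) = (\<integral>z. f (x + d *\<^sub>R z) * of_real (exp (- (norm z)\<^sup>2 / 2)) \<partial>lborel)" .
  show ?thesis
    unfolding * gauss_mean_def gauss_def integral_mult_right_zero[symmetric]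
    by (simp add: mult_ac)
qed

text \<open>The multiplication formula moves the transform from \<open>f\<close> to the product of the cutoff with
  \<open>cnj (Fh)\<close>. By the regularized inversion formula, the transform of that product is the
  conjugate of the Gaussian mean of \<open>h\<close>.\<close>

lemma parseval_regularized:
  fixes f h :: "'a::euclidean_space \<Rightarrow> complex"
  assumes f: "integrable lborel f" and h: "integrable lborel h" and d: "d > 0"
  shows "(\<integral>\<xi>. of_real (gauss_cutoff d \<xi>) * (fourier_integral f \<xi> * cnj (fourier_integral h \<xi>)) \<partial>lborel)
       = (\<integral>x. f x * cnj (gauss_mean d h x) \<partial>lborel)"
proof -
  let ?c = "(2 * pi) powr (- real DIM('a) / 2)"
  have [measurable]: "h \<in> borel_measurable borel" using h by auto
  let ?k = "\<lambda>\<xi>. of_real (gauss_cutoff d \<xi>) * cnj (fourier_integral h \<xi>)"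
  have "integrable lborel (\<lambda>\<xi>::'a. gauss_cutoff d \<xi> * (?c * (\<integral>x. cmod (h x) \<partial>lborel)))"
    using gauss_cutoff_fourier(1)[OF d, where 'a='a] by simp
  then have k: "integrable lborel ?k"
    by (rule Bochner_Integration.integrable_bound, measurable)
       (auto simp: norm_mult gauss_cutoff_def intro!: mult_left_mono order_trans[OF fourier_integral_bound])
  have "fourier_integral ?k x = cnj (gauss_mean d h x)" for x
  proof -
    have "(\<integral>\<xi>. cis (- (\<xi> \<bullet> x)) * ?k \<xi> \<partial>lborel)
        = (\<integral>\<xi>. cnj (cis (x \<bullet> \<xi>) * of_real (gauss_cutoff d \<xi>) * fourier_integral h \<xi>) \<partial>lborel)"
      by (simp add: cis_cnj inner_commute mult_ac del: integral_cnj)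
    also have "\<dots> = cnj (\<integral>\<xi>. cis (x \<bullet> \<xi>) * of_real (gauss_cutoff d \<xi>) * fourier_integral h \<xi> \<partial>lborel)"
      by (rule Bochner_Integration.integral_cnj)
    finally show ?thesis
      unfolding fourier_integral_gauss_mean[OF h d, symmetric] fourier_integral_def[of ?k] by simp
  qed
  then show ?thesis
    using fourier_integral_multiplication_formula[OF f k] by (simp add: mult_ac)
qed

section \<open>Contraction and Parseval on integrable functions\<close>

text \<open>The squared \<open>L\<^sup>2\<close> norm with values in \<open>[0, \<infinity>]\<close>, so that Fatou and Tonelli apply without
  integrability side conditions.\<close>

definition L2_sq :: "('a::euclidean_space \<Rightarrow> complex) \<Rightarrow> ennreal" where
  "L2_sq f = (\<integral>\<^sup>+x. ennreal ((cmod (f x))\<^sup>2) \<partial>lborel)"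

lemma L2_iff: "f \<in> L2 \<longleftrightarrow> f \<in> borel_measurable borel \<and> L2_sq f < \<infinity>"
  unfolding L2_def L2_sq_def by (auto simp: integrable_iff_bounded)

lemma L2_measurable [measurable_dest]: "f \<in> L2 \<Longrightarrow> f \<in> borel_measurable borel"
  by (simp add: L2_iff)

lemma integrable_L2_mult:
  assumes f: "f \<in> L2" and h: "h \<in> L2"
  shows "integrable lborel (\<lambda>x. f x * h x)"
proof (rule Bochner_Integration.integrable_bound)
  show "integrable lborel (\<lambda>x. (cmod (f x))\<^sup>2 + (cmod (h x))\<^sup>2)"
    using f h by (simp add: L2_def)
  show "(\<lambda>x. f x * h x) \<in> borel_measurable lborel"
    using f h by measurable
  have "a * b \<le> a\<^sup>2 + b\<^sup>2" if "a \<ge> 0" "b \<ge> 0" for a b :: real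
    using sum_squares_bound[of a b] mult_nonneg_nonneg[OF that] by linarith
  then show "AE x in lborel. norm (f x * h x) \<le> norm ((cmod (f x))\<^sup>2 + (cmod (h x))\<^sup>2)"
    by (simp add: norm_mult)
qed

lemma norm_integral_le_nn_integral:
  fixes f :: "'a \<Rightarrow> 'b::{banach, second_countable_topology}"
  shows "ennreal (norm (integral\<^sup>L M f)) \<le> (\<integral>\<^sup>+x. norm (f x) \<partial>M)"
proof (cases "integrable M f")
  case True
  then show ?thesis by (rule integral_norm_bound_ennreal)
qed (simp add: not_integrable_integral_eq)

text \<open>In the regularized Parseval identity with \<open>h = f\<close>, bound \<open>2 |f(x)| |f(x + d z)|\<close> by
  \<open>|f(x)|\<^sup>2 + |f(x + d z)|\<^sup>2\<close>. Each term integrates to \<open>\<integral> |f|\<^sup>2\<close>: the Gaussian has mass \<open>1\<close> and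
  Lebesgue measure is translation invariant.\<close>

lemma cutoff_parseval_le:
  fixes f :: "'a::euclidean_space \<Rightarrow> complex"
  assumes f: "integrable lborel f" and d: "d > 0"
  shows "(\<integral>\<^sup>+\<xi>. ennreal (gauss_cutoff d \<xi> * (cmod (fourier_integral f \<xi>))\<^sup>2) \<partial>lborel) \<le> L2_sq f"
proof -
  let ?F = "fourier_integral f"
  have [measurable]: "f \<in> borel_measurable borel" using f by auto
  let ?B = "(2 * pi) powr (- real DIM('a) / 2) * (\<integral>x. cmod (f x) \<partial>lborel)"
  have "integrable lborel (\<lambda>\<xi>::'a. gauss_cutoff d \<xi> * ?B\<^sup>2)"
    using gauss_cutoff_fourier(1)[OF d, where 'a='a] by simp
  then have int: "integrable lborel (\<lambda>\<xi>. gauss_cutoff d \<xi> * (cmod (?F \<xi>))\<^sup>2)"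
  proof (rule Bochner_Integration.integrable_bound)
    have "gauss_cutoff d \<xi> * (cmod (?F \<xi>))\<^sup>2 \<le> gauss_cutoff d \<xi> * ?B\<^sup>2" for \<xi>
      by (intro mult_left_mono power_mono fourier_integral_bound) (auto simp: gauss_cutoff_def)
    then show "AE \<xi> in lborel. norm (gauss_cutoff d \<xi> * (cmod (?F \<xi>))\<^sup>2) \<le> norm (gauss_cutoff d \<xi> * ?B\<^sup>2)"
      by (simp add: gauss_cutoff_def)
  qed measurable
  have "complex_of_real (\<integral>\<xi>. gauss_cutoff d \<xi> * (cmod (?F \<xi>))\<^sup>2 \<partial>lborel)
      = (\<integral>\<xi>. of_real (gauss_cutoff d \<xi>) * (?F \<xi> * cnj (?F \<xi>)) \<partial>lborel)"
    by (simp add: complex_norm_square[symmetric] flip: integral_complex_of_real)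
  also have "\<dots> = (\<integral>x. f x * cnj (gauss_mean d f x) \<partial>lborel)"
    by (rule parseval_regularized[OF f f d])
  finally have eq: "\<bar>\<integral>\<xi>. gauss_cutoff d \<xi> * (cmod (?F \<xi>))\<^sup>2 \<partial>lborel\<bar>
      = cmod (\<integral>x. f x * cnj (gauss_mean d f x) \<partial>lborel)"
    by (metis norm_of_real)
  have "(\<integral>\<^sup>+\<xi>. ennreal (gauss_cutoff d \<xi> * (cmod (?F \<xi>))\<^sup>2) \<partial>lborel)
      = ennreal (cmod (\<integral>x. f x * cnj (gauss_mean d f x) \<partial>lborel))"
    unfolding eq[symmetric]
    by (subst nn_integral_eq_integral[OF int]) (auto simp: gauss_cutoff_def)
  also have "\<dots> \<le> (\<integral>\<^sup>+x. ennreal (cmod (f x)) * (\<integral>\<^sup>+z. ennreal (gauss z * cmod (f (x + d *\<^sub>R z))) \<partial>lborel) \<partial>lborel)"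
  proof (rule order_trans[OF norm_integral_le_nn_integral nn_integral_mono])
    fix x
    have "ennreal (cmod (gauss_mean d f x)) \<le> (\<integral>\<^sup>+z. ennreal (gauss z * cmod (f (x + d *\<^sub>R z))) \<partial>lborel)"
      unfolding gauss_mean_def by (rule order_trans[OF norm_integral_le_nn_integral]) (simp add: norm_mult gauss_nonneg)
    then show "ennreal (cmod (f x * cnj (gauss_mean d f x)))
        \<le> ennreal (cmod (f x)) * (\<integral>\<^sup>+z. ennreal (gauss z * cmod (f (x + d *\<^sub>R z))) \<partial>lborel)"
      by (simp add: norm_mult ennreal_mult mult_left_mono)
  qed
  also have "\<dots> = (\<integral>\<^sup>+x. \<integral>\<^sup>+z. ennreal (cmod (f x) * (gauss z * cmod (f (x + d *\<^sub>R z)))) \<partial>lborel \<partial>lborel)"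
    by (simp add: ennreal_mult gauss_nonneg nn_integral_cmult)
  finally have 1: "(\<integral>\<^sup>+\<xi>. ennreal (gauss_cutoff d \<xi> * (cmod (?F \<xi>))\<^sup>2) \<partial>lborel)
      \<le> (\<integral>\<^sup>+x. \<integral>\<^sup>+z. ennreal (cmod (f x) * (gauss z * cmod (f (x + d *\<^sub>R z)))) \<partial>lborel \<partial>lborel)" .
  have le: "2 * ennreal (cmod (f x) * (gauss z * cmod (f (x + d *\<^sub>R z))))
      \<le> ennreal ((cmod (f x))\<^sup>2) * ennreal (gauss z) + ennreal ((cmod (f (x + d *\<^sub>R z)))\<^sup>2) * ennreal (gauss z)" for x z
  proof -
    have "2 * (cmod (f x) * (gauss z * cmod (f (x + d *\<^sub>R z))))
        \<le> (cmod (f x))\<^sup>2 * gauss z + (cmod (f (x + d *\<^sub>R z)))\<^sup>2 * gauss z"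
      using mult_right_mono[OF sum_squares_bound[of "cmod (f x)" "cmod (f (x + d *\<^sub>R z))"] gauss_nonneg[of z]]
      by (simp add: algebra_simps)
    then have "ennreal (2 * (cmod (f x) * (gauss z * cmod (f (x + d *\<^sub>R z)))))
        \<le> ennreal ((cmod (f x))\<^sup>2 * gauss z + (cmod (f (x + d *\<^sub>R z)))\<^sup>2 * gauss z)"
      by (rule ennreal_leI)
    then show ?thesis
      by (simp add: gauss_nonneg ennreal_mult)
  qed
  have "(\<integral>\<^sup>+x. \<integral>\<^sup>+z. ennreal ((cmod (f (x + d *\<^sub>R z)))\<^sup>2) * ennreal (gauss z) \<partial>lborel \<partial>lborel)
      = (\<integral>\<^sup>+z. \<integral>\<^sup>+x. ennreal ((cmod (f (x + d *\<^sub>R z)))\<^sup>2) * ennreal (gauss z) \<partial>lborel \<partial>lborel)"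
    by (rule lborel_pair.Fubini'[symmetric]) measurable
  also have "\<dots> = (\<integral>\<^sup>+z. L2_sq f * ennreal (gauss (z::'a)) \<partial>lborel)"
  proof (rule nn_integral_cong)
    fix z :: 'a
    have "L2_sq f = (\<integral>\<^sup>+x. ennreal ((cmod (f (x + d *\<^sub>R z)))\<^sup>2) \<partial>lborel)"
      unfolding L2_sq_def
      by (subst lborel_nn_integral_affine[where c=1 and t="d *\<^sub>R z"]) (simp_all add: add.commute)
    then show "(\<integral>\<^sup>+x. ennreal ((cmod (f (x + d *\<^sub>R z)))\<^sup>2) * ennreal (gauss z) \<partial>lborel) = L2_sq f * ennreal (gauss z)"
      by (simp add: nn_integral_multc)
  qed
  finally have 2: "(\<integral>\<^sup>+x. \<integral>\<^sup>+z. ennreal ((cmod (f (x + d *\<^sub>R z)))\<^sup>2) * ennreal (gauss z) \<partial>lborel \<partial>lborel) = L2_sq f"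
    by (simp add: nn_integral_cmult nn_integral_gauss)
  have "2 * (\<integral>\<^sup>+x. \<integral>\<^sup>+z. ennreal (cmod (f x) * (gauss z * cmod (f (x + d *\<^sub>R z)))) \<partial>lborel \<partial>lborel)
     = (\<integral>\<^sup>+x. \<integral>\<^sup>+z. 2 * ennreal (cmod (f x) * (gauss z * cmod (f (x + d *\<^sub>R z)))) \<partial>lborel \<partial>lborel)"
    by (simp add: nn_integral_cmult)
  also have "\<dots> \<le> (\<integral>\<^sup>+x. \<integral>\<^sup>+z. ennreal ((cmod (f x))\<^sup>2) * ennreal (gauss z)
       + ennreal ((cmod (f (x + d *\<^sub>R z)))\<^sup>2) * ennreal (gauss z) \<partial>lborel \<partial>lborel)"
    by (intro nn_integral_mono le)
  also have "\<dots> = 2 * L2_sq f"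
    by (simp add: nn_integral_add nn_integral_cmult nn_integral_gauss 2 L2_sq_def[symmetric] mult_2)
  finally have "(\<integral>\<^sup>+x. \<integral>\<^sup>+z. ennreal (cmod (f x) * (gauss z * cmod (f (x + d *\<^sub>R z)))) \<partial>lborel \<partial>lborel) \<le> L2_sq f"
    by (subst (asm) ennreal_mult_le_mult_iff) auto
  with 1 show ?thesis by (rule order_trans)
qed

lemma gauss_cutoff_tendsto: "(\<lambda>k. gauss_cutoff (inverse (real (Suc k))) \<xi>) \<longlonglongrightarrow> 1"
proof -
  have "(\<lambda>k. exp (- (inverse (real (Suc k)) * norm \<xi>)\<^sup>2 / 2)) \<longlonglongrightarrow> exp (- (0 * norm \<xi>)\<^sup>2 / 2)"
    by (intro tendsto_intros LIMSEQ_inverse_real_of_nat) simp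
  then show ?thesis by (simp add: gauss_cutoff_def)
qed

text \<open>Let the cutoff tend to \<open>1\<close> and apply Fatou.\<close>

lemma fourier_integral_contraction:
  fixes f :: "'a::euclidean_space \<Rightarrow> complex"
  assumes f: "integrable lborel f"
  shows "L2_sq (fourier_integral f) \<le> L2_sq f"
proof -
  let ?u = "\<lambda>k \<xi>. ennreal (gauss_cutoff (inverse (real (Suc k))) \<xi> * (cmod (fourier_integral f \<xi>))\<^sup>2)"
  have [measurable]: "f \<in> borel_measurable borel" using f by auto
  have "(\<lambda>k. ?u k \<xi>) \<longlonglongrightarrow> ennreal (1 * (cmod (fourier_integral f \<xi>))\<^sup>2)" for \<xi>
    by (intro tendsto_intros gauss_cutoff_tendsto)
  then have "ennreal ((cmod (fourier_integral f \<xi>))\<^sup>2) = liminf (\<lambda>k. ?u k \<xi>)" for \<xi>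
    by (intro lim_imp_Liminf[symmetric]) auto
  then have "L2_sq (fourier_integral f) = (\<integral>\<^sup>+\<xi>. liminf (\<lambda>k. ?u k \<xi>) \<partial>lborel)"
    by (simp add: L2_sq_def)
  also have "\<dots> \<le> liminf (\<lambda>k. \<integral>\<^sup>+\<xi>. ?u k \<xi> \<partial>lborel)"
    by (intro nn_integral_liminf) measurable
  also have "\<dots> \<le> limsup (\<lambda>k. \<integral>\<^sup>+\<xi>. ?u k \<xi> \<partial>lborel)"
    by (rule Liminf_le_Limsup) simp
  also have "\<dots> \<le> L2_sq f"
    by (intro Limsup_bounded always_eventually allI cutoff_parseval_le f) auto
  finally show ?thesis .
qed

lemma fourier_integral_L2:
  assumes "integrable lborel f" "f \<in> L2"
  shows "fourier_integral f \<in> L2"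
  using fourier_integral_contraction[OF assms(1)] assms(2)
  by (auto simp: L2_iff)

lemma gauss_mean_tendsto:
  fixes h :: "'a::euclidean_space \<Rightarrow> complex"
  assumes [measurable]: "h \<in> borel_measurable borel" and bd: "\<And>x. cmod (h x) \<le> B" and c: "isCont h x"
  shows "(\<lambda>k. gauss_mean (inverse (real (Suc k))) h x) \<longlonglongrightarrow> h x"
proof -
  have "(\<lambda>k. \<integral>z. of_real (gauss z) * h (x + inverse (real (Suc k)) *\<^sub>R z) \<partial>lborel)
     \<longlonglongrightarrow> (\<integral>z. of_real (gauss (z::'a)) * h x \<partial>lborel)"
  proof (rule integral_dominated_convergence[where w = "\<lambda>z::'a. gauss z * B"])
    show "integrable lborel (\<lambda>z::'a. gauss z * B)"
      using gauss_integrable[where 'a='a] by simp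
    show "AE z in lborel. (\<lambda>k. complex_of_real (gauss z) * h (x + inverse (real (Suc k)) *\<^sub>R z)) \<longlonglongrightarrow> of_real (gauss z) * h x"
    proof (rule AE_I2)
      fix z :: 'a
      have "(\<lambda>k. x + inverse (real (Suc k)) *\<^sub>R z) \<longlonglongrightarrow> x + 0 *\<^sub>R z"
        by (intro tendsto_intros LIMSEQ_inverse_real_of_nat)
      then have "(\<lambda>k. h (x + inverse (real (Suc k)) *\<^sub>R z)) \<longlonglongrightarrow> h x"
        by (intro isCont_tendsto_compose[OF c]) (simp only: scaleR_zero_left add_0_right)
      then show "(\<lambda>k. complex_of_real (gauss z) * h (x + inverse (real (Suc k)) *\<^sub>R z)) \<longlonglongrightarrow> of_real (gauss z) * h x"
        by (intro tendsto_intros)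
    qed
  qed (auto simp: norm_mult gauss_nonneg intro!: mult_left_mono bd)
  moreover have "(\<integral>z. complex_of_real (gauss (z::'a)) * h x \<partial>lborel) = h x"
    by (simp add: gauss_integral)
  ultimately show ?thesis by (simp only: gauss_mean_def)
qed

lemma gauss_mean_bound:
  fixes h :: "'a::euclidean_space \<Rightarrow> complex"
  assumes [measurable]: "h \<in> borel_measurable borel" and bd: "\<And>x. cmod (h x) \<le> B"
  shows "cmod (gauss_mean d h x) \<le> B"
proof -
  have "cmod (gauss_mean d h x) \<le> (\<integral>z. gauss (z::'a) * B \<partial>lborel)"
    unfolding gauss_mean_def
  proof (rule Bochner_Integration.integral_norm_bound_integral)
    show i: "integrable lborel (\<lambda>z::'a. gauss z * B)"
      using gauss_integrable[where 'a='a] by simp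
    show "norm (complex_of_real (gauss z) * h (x + d *\<^sub>R z)) \<le> gauss z * B" for z :: 'a
      by (auto simp: norm_mult gauss_nonneg intro!: mult_left_mono bd)
    show "integrable lborel (\<lambda>z. complex_of_real (gauss z) * h (x + d *\<^sub>R z))"
      by (rule Bochner_Integration.integrable_bound[OF i])
        (auto simp: norm_mult gauss_nonneg intro!: AE_I2 order_trans[OF mult_left_mono[OF bd] abs_ge_self])
  qed
  then show ?thesis by (simp add: gauss_integral)
qed

lemma gauss_mean_measurable [measurable]:
  assumes [measurable]: "h \<in> borel_measurable borel"
  shows "gauss_mean d h \<in> borel_measurable borel"
  unfolding gauss_mean_def by measurable

lemma indicator_box_L2:
  fixes a b :: "'a::euclidean_space"
  shows "integrable lborel (indicator (box a b) :: 'a \<Rightarrow> complex)"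
    and "(indicator (box a b) :: 'a \<Rightarrow> complex) \<in> L2"
proof -
  show 1: "integrable lborel (indicator (box a b) :: 'a \<Rightarrow> complex)"
  proof -
    have "integrable lborel (\<lambda>x. complex_of_real (indicator (box a b) x))"
      by (intro integrable_of_real integrable_real_indicator emeasure_bounded_finite) auto
    moreover have "(\<lambda>x. complex_of_real (indicator (box a b) x)) = indicator (box a b)"
      by (auto simp: indicator_def)
    ultimately show ?thesis by simp
  qed
  have "(\<lambda>x. (cmod (indicator (box a b) x))\<^sup>2) = (indicator (box a b) :: 'a \<Rightarrow> real)"
    by (auto simp: indicator_def)
  then show "(indicator (box a b) :: 'a \<Rightarrow> complex) \<in> L2"
    using emeasure_bounded_finite[of "box a b"] by (simp add: L2_def integrable_indicator_iff)
qed

text \<open>Let \<open>d \<rightarrow> 0\<close> in the regularized identity. On the left, the contraction property makes the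
  product of the two transforms integrable, hence a dominating function. On the right, the
  Gaussian means of the indicator stay bounded by \<open>1\<close> and converge off the boundary of the box,
  which is a null set.\<close>

lemma parseval_box:
  fixes f :: "'a::euclidean_space \<Rightarrow> complex"
  assumes f: "integrable lborel f" and f2: "f \<in> L2"
  shows "(\<integral>\<xi>. fourier_integral f \<xi> * cnj (fourier_integral (indicator (box a b)) \<xi>) \<partial>lborel)
     = (\<integral>x. f x * indicator (box a b) x \<partial>lborel)"
proof -
  let ?h = "indicator (box a b) :: 'a \<Rightarrow> complex"
  let ?d = "\<lambda>k. inverse (real (Suc k))"
  have [measurable]: "f \<in> borel_measurable borel" using f by auto
  have "(\<lambda>k. \<integral>\<xi>. of_real (gauss_cutoff (?d k) \<xi>) * (fourier_integral f \<xi> * cnj (fourier_integral ?h \<xi>)) \<partial>lborel)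
      \<longlonglongrightarrow> (\<integral>\<xi>. fourier_integral f \<xi> * cnj (fourier_integral ?h \<xi>) \<partial>lborel)"
  proof (rule integral_dominated_convergence[where w = "\<lambda>\<xi>. cmod (fourier_integral f \<xi> * fourier_integral ?h \<xi>)"])
    show "integrable lborel (\<lambda>\<xi>. cmod (fourier_integral f \<xi> * fourier_integral ?h \<xi>))"
      by (intro integrable_norm integrable_L2_mult fourier_integral_L2 f f2 indicator_box_L2)
    show "(\<lambda>\<xi>. fourier_integral f \<xi> * cnj (fourier_integral ?h \<xi>)) \<in> borel_measurable lborel"
      by measurable
    show "(\<lambda>\<xi>. of_real (gauss_cutoff (?d k) \<xi>) * (fourier_integral f \<xi> * cnj (fourier_integral ?h \<xi>)))
        \<in> borel_measurable lborel" for k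
      by measurable
    have "(\<lambda>k. of_real (gauss_cutoff (?d k) \<xi>) * (fourier_integral f \<xi> * cnj (fourier_integral ?h \<xi>)))
       \<longlonglongrightarrow> of_real 1 * (fourier_integral f \<xi> * cnj (fourier_integral ?h \<xi>))" for \<xi>
      by (intro tendsto_intros gauss_cutoff_tendsto)
    then show "AE \<xi> in lborel. (\<lambda>k. of_real (gauss_cutoff (?d k) \<xi>) * (fourier_integral f \<xi> * cnj (fourier_integral ?h \<xi>)))
       \<longlonglongrightarrow> fourier_integral f \<xi> * cnj (fourier_integral ?h \<xi>)"
      by simp
  qed (auto simp: norm_mult gauss_cutoff_def intro!: mult_left_le_one_le)
  moreover have "(\<lambda>k. \<integral>x. f x * cnj (gauss_mean (?d k) ?h x) \<partial>lborel) \<longlonglongrightarrow> (\<integral>x. f x * ?h x \<partial>lborel)"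
  proof (rule integral_dominated_convergence[where w = "\<lambda>x. cmod (f x)"])
    have "frontier (box a b) \<in> null_sets lborel"
      using negligible_convex_frontier[of "box a b"]
      by (simp add: negligible_iff_null_sets null_sets_completion_iff)
    then have "AE x in lborel. x \<notin> frontier (box a b)" by (rule AE_not_in)
    then show "AE x in lborel. (\<lambda>k. f x * cnj (gauss_mean (?d k) ?h x)) \<longlonglongrightarrow> f x * ?h x"
    proof eventually_elim
      case (elim x)
      have "isCont (\<lambda>x. complex_of_real (indicator (box a b) x)) x"
        using elim by (intro continuous_intros) (simp add: isCont_indicator)
      moreover have "(\<lambda>x. complex_of_real (indicator (box a b) x)) = ?h"
        by (auto simp: indicator_def)
      ultimately have "(\<lambda>k. f x * cnj (gauss_mean (?d k) ?h x)) \<longlonglongrightarrow> f x * cnj (?h x)"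
        by (intro tendsto_intros gauss_mean_tendsto[where B=1]) (auto simp: indicator_def)
      moreover have "cnj (?h x) = ?h x"
        by (simp add: indicator_def)
      ultimately show ?case by (simp only:)
    qed
    show "AE x in lborel. norm (f x * cnj (gauss_mean (?d k) ?h x)) \<le> cmod (f x)" for k
      using gauss_mean_bound[of ?h 1 "?d k"]
      by (intro AE_I2) (auto simp: norm_mult indicator_def intro!: mult_left_le)
  qed (use f in auto)
  moreover have "(\<integral>\<xi>. of_real (gauss_cutoff (?d k) \<xi>) * (fourier_integral f \<xi> * cnj (fourier_integral ?h \<xi>)) \<partial>lborel)
     = (\<integral>x. f x * cnj (gauss_mean (?d k) ?h x) \<partial>lborel)" for k
    by (rule parseval_regularized[OF f indicator_box_L2(1)]) simp
  ultimately show ?thesis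
    using LIMSEQ_unique by simp
qed

section \<open>Square-integrable functions\<close>

text \<open>Boxes are an intersection-stable generator of the Borel sets. So, after localizing to a fixed
  box, Dynkin induction shows that the integral over every Borel set vanishes.\<close>

lemma AE_eq_0_if_box_integrals_0:
  fixes f :: "'a::euclidean_space \<Rightarrow> complex"
  assumes f: "\<And>a b. integrable lborel (\<lambda>x. f x * indicator (box a b) x)"
    and z: "\<And>a b. (\<integral>x. f x * indicator (box a b) x \<partial>lborel) = 0"
  shows "AE x in lborel. f x = 0"
proof -
  let ?E = "range (\<lambda>(a, b). box a b :: 'a set)"
  have "AE x in lborel. f x * indicator (box a b) x = 0" for a b
  proof (rule sigma_finite_measure.density_zero[OF sigma_finite_lborel f])
    let ?g = "\<lambda>x. f x * indicator (box a b) x"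
    fix A :: "'a set"
    assume "A \<in> sets lborel"
    then have A: "A \<in> sigma_sets UNIV ?E" by (simp add: borel_eq_box)
    have "Int_stable ?E"
      by (auto simp: Int_stable_def box_Int_box)
    moreover have "?E \<subseteq> Pow UNIV"
      by auto
    ultimately show "set_lebesgue_integral lborel A ?g = 0"
      using A
    proof (induction rule: sigma_sets_induct_disjoint)
      case (basic A)
      then obtain c d where A: "A = box c d" by auto
      obtain p q where pq: "box a b \<inter> box c d = box p q"
        by (auto simp: box_Int_box)
      have "(\<lambda>x. indicat_real A x *\<^sub>R ?g x) = (\<lambda>x. f x * indicator (box p q) x)"
        unfolding A pq[symmetric] by (auto simp: indicator_def)
      then show ?case
        by (simp add: set_lebesgue_integral_def z)
    next
      case empty
      then show ?case by (simp add: set_lebesgue_integral_def)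
    next
      case (compl A)
      then have [measurable]: "A \<in> sets borel" by (simp add: borel_eq_box)
      have "set_lebesgue_integral lborel (UNIV - A) ?g = (\<integral>x. ?g x - indicat_real A x *\<^sub>R ?g x \<partial>lborel)"
        unfolding set_lebesgue_integral_def by (intro Bochner_Integration.integral_cong) (auto simp: indicator_def)
      also have "\<dots> = (\<integral>x. ?g x \<partial>lborel) - (\<integral>x. indicat_real A x *\<^sub>R ?g x \<partial>lborel)"
        by (intro Bochner_Integration.integral_diff integrable_mult_indicator f) auto
      also have "\<dots> = 0"
        using compl.IH by (simp only: z set_lebesgue_integral_def) simp
      finally show ?case .
    next
      case (union F)
      have [measurable]: "F i \<in> sets borel" for i
        using union.hyps by (auto simp add: borel_eq_box subset_eq)
      have "set_lebesgue_integral lborel (\<Union>i. F i) ?g = (\<Sum>i. set_lebesgue_integral lborel (F i) ?g)"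
        using union.hyps(1)
        by (intro lebesgue_integral_countable_add)
          (auto simp: disjoint_family_on_def set_integrable_def intro!: integrable_mult_indicator f)
      then show ?case by (simp add: union.IH)
    qed
  qed
  then have "AE x in lborel. \<forall>n::nat. f x * indicator (box (- (real n *\<^sub>R One)) (real n *\<^sub>R One)) x = 0"
    by (intro AE_all_countable[THEN iffD2] allI)
  then show ?thesis
  proof eventually_elim
    case (elim x)
    have "x \<in> (\<Union>n::nat. box (- (real n *\<^sub>R One)) (real n *\<^sub>R One))"
      by (simp only: UN_box_eq_UNIV UNIV_I)
    then obtain n :: nat where "x \<in> box (- (real n *\<^sub>R One)) (real n *\<^sub>R One)" by blast
    with elim[rule_format, of n] show ?case by simp
  qed
qed

lemma L2_sq_add_le:
  assumes [measurable]: "f \<in> borel_measurable borel" "h \<in> borel_measurable borel"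
  shows "L2_sq (\<lambda>x. f x + h x) \<le> 2 * L2_sq f + 2 * L2_sq h"
proof -
  have "(cmod (f x + h x))\<^sup>2 \<le> 2 * (cmod (f x))\<^sup>2 + 2 * (cmod (h x))\<^sup>2" for x
  proof -
    have "(cmod (f x + h x))\<^sup>2 \<le> (cmod (f x) + cmod (h x))\<^sup>2"
      by (intro power_mono norm_triangle_ineq) simp
    also have "\<dots> \<le> 2 * (cmod (f x))\<^sup>2 + 2 * (cmod (h x))\<^sup>2"
      using sum_squares_bound[of "cmod (f x)" "cmod (h x)"] by (simp add: power2_sum)
    finally show ?thesis .
  qed
  then have "ennreal ((cmod (f x + h x))\<^sup>2) \<le> 2 * ennreal ((cmod (f x))\<^sup>2) + 2 * ennreal ((cmod (h x))\<^sup>2)" for x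
    using ennreal_leI by (fastforce simp: ennreal_mult)
  then have "L2_sq (\<lambda>x. f x + h x) \<le> (\<integral>\<^sup>+x. 2 * ennreal ((cmod (f x))\<^sup>2) + 2 * ennreal ((cmod (h x))\<^sup>2) \<partial>lborel)"
    unfolding L2_sq_def by (intro nn_integral_mono)
  also have "\<dots> = 2 * L2_sq f + 2 * L2_sq h"
    unfolding L2_sq_def by (simp add: nn_integral_add nn_integral_cmult)
  finally show ?thesis .
qed

lemma L2_sq_uminus: "L2_sq (\<lambda>x. - f x) = L2_sq f"
  by (simp add: L2_sq_def)

lemma L2_sq_minus_commute: "L2_sq (\<lambda>x. f x - h x) = L2_sq (\<lambda>x. h x - f x)"
  by (simp add: L2_sq_def norm_minus_commute)

text \<open>A quasi-triangle inequality through an intermediate point \<open>k\<close>. The factor \<open>2\<close> is harmless for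
  convergence arguments and avoids square roots of extended reals.\<close>

lemma L2_sq_diff_le:
  assumes [measurable]: "f \<in> borel_measurable borel" "h \<in> borel_measurable borel" "k \<in> borel_measurable borel"
  shows "L2_sq (\<lambda>x. f x - h x) \<le> 2 * L2_sq (\<lambda>x. k x - f x) + 2 * L2_sq (\<lambda>x. k x - h x)"
proof -
  have "L2_sq (\<lambda>x. (f x - k x) + (k x - h x)) \<le> 2 * L2_sq (\<lambda>x. f x - k x) + 2 * L2_sq (\<lambda>x. k x - h x)"
    by (intro L2_sq_add_le) measurable
  then show ?thesis by (simp add: L2_sq_minus_commute[of f k])
qed

lemma L2_diff: "f \<in> L2 \<Longrightarrow> h \<in> L2 \<Longrightarrow> (\<lambda>x. f x - h x) \<in> L2"
proof -
  assume f: "f \<in> L2" and h: "h \<in> L2"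
  have [measurable]: "f \<in> borel_measurable borel" "h \<in> borel_measurable borel"
    using f h by (auto simp: L2_iff)
  have "L2_sq (\<lambda>x. f x + - h x) \<le> 2 * L2_sq f + 2 * L2_sq (\<lambda>x. - h x)"
    by (intro L2_sq_add_le) measurable
  also have "\<dots> < \<infinity>"
    using f h by (simp add: L2_iff L2_sq_uminus ennreal_mult_less_top)
  finally show ?thesis by (simp add: L2_iff)
qed

lemma L2_sq_eq_0_iff:
  assumes [measurable]: "f \<in> borel_measurable borel"
  shows "L2_sq f = 0 \<longleftrightarrow> (AE x in lborel. f x = 0)"
  unfolding L2_sq_def by (subst nn_integral_0_iff_AE) (auto simp: ennreal_eq_0_iff)

text \<open>By the Cauchy-Schwarz inequality.\<close>

lemma L2_inner_tendsto:
  fixes F :: "'i \<Rightarrow> 'a::euclidean_space \<Rightarrow> complex"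
  assumes F: "\<And>i. F i \<in> L2" and G: "G \<in> L2" and h: "h \<in> L2"
    and lim: "((\<lambda>i. L2_sq (\<lambda>x. G x - F i x)) \<longlongrightarrow> 0) K"
  shows "((\<lambda>i. \<integral>x. F i x * h x \<partial>lborel) \<longlongrightarrow> (\<integral>x. G x * h x \<partial>lborel)) K"
proof -
  have [measurable]: "F i \<in> borel_measurable borel" "G \<in> borel_measurable borel" "h \<in> borel_measurable borel" for i
    using F G h by (auto simp: L2_iff)
  have hfin: "L2_sq h < \<infinity>" using h by (simp add: L2_iff)
  have le: "ennreal ((dist (\<integral>x. F i x * h x \<partial>lborel) (\<integral>x. G x * h x \<partial>lborel))\<^sup>2)
      \<le> L2_sq h * L2_sq (\<lambda>x. G x - F i x)" for i
  proof -
    have "(\<integral>x. G x * h x \<partial>lborel) - (\<integral>x. F i x * h x \<partial>lborel) = (\<integral>x. (G x - F i x) * h x \<partial>lborel)"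
      by (simp add: left_diff_distrib Bochner_Integration.integral_diff integrable_L2_mult F G h)
    then have "dist (\<integral>x. F i x * h x \<partial>lborel) (\<integral>x. G x * h x \<partial>lborel) = cmod (\<integral>x. (G x - F i x) * h x \<partial>lborel)"
      by (metis dist_norm norm_minus_commute)
    also have "ennreal \<dots> \<le> (\<integral>\<^sup>+x. ennreal (cmod (h x)) * ennreal (cmod (G x - F i x)) \<partial>lborel)"
      by (rule order_trans[OF norm_integral_le_nn_integral]) (simp add: norm_mult ennreal_mult mult.commute)
    finally have "(ennreal (dist (\<integral>x. F i x * h x \<partial>lborel) (\<integral>x. G x * h x \<partial>lborel)))\<^sup>2
        \<le> (\<integral>\<^sup>+x. ennreal (cmod (h x)) * ennreal (cmod (G x - F i x)) \<partial>lborel)\<^sup>2"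
      by (intro power_mono) auto
    also have "\<dots> \<le> L2_sq h * L2_sq (\<lambda>x. G x - F i x)"
      unfolding L2_sq_def ennreal_power[OF norm_ge_zero, symmetric]
      by (rule Cauchy_Schwarz_nn_integral) measurable
    finally show ?thesis by (simp add: ennreal_power)
  qed
  have z: "((\<lambda>i. L2_sq h * L2_sq (\<lambda>x. G x - F i x)) \<longlongrightarrow> L2_sq h * 0) K"
    using hfin by (intro ennreal_tendsto_cmult lim) auto
  have "((\<lambda>i. ennreal ((dist (\<integral>x. F i x * h x \<partial>lborel) (\<integral>x. G x * h x \<partial>lborel))\<^sup>2)) \<longlongrightarrow> 0) K"
    by (rule tendsto_sandwich[OF _ _ tendsto_const z[unfolded mult_zero_right]]) (auto intro!: always_eventually le)
  then have "((\<lambda>i. (dist (\<integral>x. F i x * h x \<partial>lborel) (\<integral>x. G x * h x \<partial>lborel))\<^sup>2) \<longlongrightarrow> 0) K"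
    by (subst (asm) tendsto_ennreal_iff[where x=0, simplified]) auto
  then have "((\<lambda>i. sqrt ((dist (\<integral>x. F i x * h x \<partial>lborel) (\<integral>x. G x * h x \<partial>lborel))\<^sup>2)) \<longlongrightarrow> sqrt 0) K"
    by (intro tendsto_intros)
  then show ?thesis
    by (subst tendsto_dist_iff) simp
qed

lemma L2_sq_le_liminf:
  fixes \<phi> :: "nat \<Rightarrow> 'a::euclidean_space \<Rightarrow> complex"
  assumes [measurable]: "\<And>k. \<phi> k \<in> borel_measurable borel"
    and lim: "AE x in lborel. (\<lambda>k. \<phi> k x) \<longlonglongrightarrow> F x"
  shows "L2_sq F \<le> liminf (\<lambda>k. L2_sq (\<phi> k))"
proof -
  have "AE x in lborel. ennreal ((cmod (F x))\<^sup>2) = liminf (\<lambda>k. ennreal ((cmod (\<phi> k x))\<^sup>2))"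
    using lim
  proof eventually_elim
    case (elim x)
    then have "(\<lambda>k. ennreal ((cmod (\<phi> k x))\<^sup>2)) \<longlonglongrightarrow> ennreal ((cmod (F x))\<^sup>2)"
      by (intro tendsto_intros)
    then show ?case by (intro lim_imp_Liminf[symmetric]) auto
  qed
  then have "L2_sq F = (\<integral>\<^sup>+x. liminf (\<lambda>k. ennreal ((cmod (\<phi> k x))\<^sup>2)) \<partial>lborel)"
    unfolding L2_sq_def by (rule nn_integral_cong_AE)
  also have "\<dots> \<le> liminf (\<lambda>k. L2_sq (\<phi> k))"
    unfolding L2_sq_def by (intro nn_integral_liminf) measurable
  finally show ?thesis .
qed

text \<open>The core of the Riesz-Fischer argument. With \<open>d\<^sub>k\<close> the \<open>k\<close>-th increment, the weights \<open>2\<^sup>k\<close>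
  still leave \<open>\<Sum> 2\<^sup>k |d\<^sub>k|\<^sup>2\<close> integrable, hence finite almost everywhere, and
  \<open>|d\<^sub>k| \<le> 2\<^sup>k |d\<^sub>k|\<^sup>2 + 2\<^sup>-\<^sup>k\<close> then makes the increments absolutely summable.\<close>

lemma AE_convergent_if_fast_Cauchy:
  fixes \<phi> :: "nat \<Rightarrow> 'a::euclidean_space \<Rightarrow> complex"
  assumes [measurable]: "\<And>k. \<phi> k \<in> borel_measurable borel"
    and fast: "\<And>k. L2_sq (\<lambda>x. \<phi> (Suc k) x - \<phi> k x) \<le> ennreal (C * (1/4) ^ k)" and C: "C \<ge> 0"
  shows "AE x in lborel. convergent (\<lambda>k. \<phi> k x)"
proof -
  let ?d = "\<lambda>k x. cmod (\<phi> (Suc k) x - \<phi> k x)"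
  have "(\<integral>\<^sup>+x. (\<Sum>k. ennreal (2 ^ k * (?d k x)\<^sup>2)) \<partial>lborel) = (\<Sum>k. \<integral>\<^sup>+x. ennreal (2 ^ k * (?d k x)\<^sup>2) \<partial>lborel)"
    by (intro nn_integral_suminf) measurable
  also have "\<dots> = (\<Sum>k. ennreal (2 ^ k) * L2_sq (\<lambda>x. \<phi> (Suc k) x - \<phi> k x))"
    unfolding L2_sq_def by (simp add: ennreal_mult nn_integral_cmult)
  also have "\<dots> \<le> (\<Sum>k. ennreal (C * (1/2) ^ k))"
  proof (intro suminf_le)
    fix k :: nat
    have "ennreal (2 ^ k) * L2_sq (\<lambda>x. \<phi> (Suc k) x - \<phi> k x) \<le> ennreal (2 ^ k) * ennreal (C * (1/4) ^ k)"
      by (intro mult_left_mono fast) simp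
    also have "\<dots> = ennreal (2 ^ k * (C * (1/4) ^ k))"
      using C by (simp add: ennreal_mult)
    also have "2 ^ k * (C * (1/4) ^ k) = C * (1/2) ^ k"
      by (simp add: power_mult_distrib[symmetric] mult.left_commute)
    finally show "ennreal (2 ^ k) * L2_sq (\<lambda>x. \<phi> (Suc k) x - \<phi> k x) \<le> ennreal (C * (1/2) ^ k)" .
  qed auto
  also have "\<dots> < \<infinity>"
    using C by (subst suminf_ennreal2) (auto intro!: summable_mult summable_geometric)
  finally have "(\<integral>\<^sup>+x. (\<Sum>k. ennreal (2 ^ k * (?d k x)\<^sup>2)) \<partial>lborel) \<noteq> \<infinity>"
    by simp
  then have "AE x in lborel. (\<Sum>k. ennreal (2 ^ k * (?d k x)\<^sup>2)) \<noteq> \<infinity>"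
    by (intro nn_integral_noteq_infinite) measurable
  then show ?thesis
  proof eventually_elim
    case (elim x)
    then have s: "summable (\<lambda>k. 2 ^ k * (?d k x)\<^sup>2)"
      by (intro summable_suminf_not_top) auto
    have "summable (\<lambda>k. \<phi> (Suc k) x - \<phi> k x)"
    proof (rule summable_comparison_test')
      show "summable (\<lambda>k. 2 ^ k * (?d k x)\<^sup>2 + (1/2) ^ k)"
        by (intro summable_add s summable_geometric) simp
      fix k :: nat
      have "y \<le> y\<^sup>2 + 1" if "y \<ge> 0" for y :: real
        using sum_squares_bound[of y 1] that by simp
      \<comment> \<open>The instance is the claim multiplied by \<open>2 ^ k\<close>.\<close>
      from this[of "2 ^ k * ?d k x"] have "2 ^ k * ?d k x \<le> 2 ^ k * (2 ^ k * (?d k x)\<^sup>2 + (1/2) ^ k)"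
        by (simp add: distrib_left power_divide power2_eq_square mult_ac)
      then show "cmod (\<phi> (Suc k) x - \<phi> k x) \<le> 2 ^ k * (?d k x)\<^sup>2 + (1/2) ^ k"
        by (rule mult_left_le_imp_le) simp
    qed
    then have "(\<lambda>n. \<phi> 0 x + (\<Sum>k<n. \<phi> (Suc k) x - \<phi> k x)) \<longlonglongrightarrow> \<phi> 0 x + (\<Sum>k. \<phi> (Suc k) x - \<phi> k x)"
      by (intro tendsto_intros summable_LIMSEQ)
    moreover have "\<phi> 0 x + (\<Sum>k<n. \<phi> (Suc k) x - \<phi> k x) = \<phi> n x" for n
      using sum_lessThan_telescope[of "\<lambda>k. \<phi> k x" n] by simp
    ultimately show ?case
      by (auto simp: convergent_def)
  qed
qed

section \<open>The Fourier transform on square-integrable functions\<close>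

definition truncate_ball :: "real \<Rightarrow> ('a::euclidean_space \<Rightarrow> complex) \<Rightarrow> 'a \<Rightarrow> complex" where
  "truncate_ball R f = (\<lambda>x. indicator (ball 0 R) x * f x)"

lemma truncate_ball_measurable [measurable]:
  fixes f :: "'a::euclidean_space \<Rightarrow> complex"
  assumes [measurable]: "f \<in> borel_measurable borel"
  shows "truncate_ball R f \<in> borel_measurable borel"
proof -
  have [measurable]: "ball 0 R \<in> sets (borel :: 'a measure)" by simp
  show ?thesis unfolding truncate_ball_def by measurable
qed

lemma has_L2_fourier_iff:
  "has_L2_fourier f F \<longleftrightarrow> f \<in> L2 \<and> F \<in> L2 \<and>
    ((\<lambda>R. L2_sq (\<lambda>\<xi>. F \<xi> - fourier_integral (truncate_ball R f) \<xi>)) \<longlongrightarrow> 0) at_top"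
  unfolding has_L2_fourier_def L2_sq_def truncate_ball_def ..

lemma truncate_ball_L2:
  fixes f :: "'a::euclidean_space \<Rightarrow> complex"
  assumes f: "f \<in> L2"
  shows "truncate_ball R f \<in> L2" and "integrable lborel (truncate_ball R f)" and "L2_sq (truncate_ball R f) \<le> L2_sq f"
proof -
  have [measurable]: "f \<in> borel_measurable borel" using f by (simp add: L2_iff)
  show le: "L2_sq (truncate_ball R f) \<le> L2_sq f"
    unfolding L2_sq_def truncate_ball_def by (intro nn_integral_mono) (auto simp: indicator_def)
  show "truncate_ball R f \<in> L2"
    using le f by (auto simp: L2_iff intro: truncate_ball_measurable)
  have "(\<lambda>x. (cmod (indicator (ball 0 R) x))\<^sup>2) = (indicator (ball 0 R) :: 'a \<Rightarrow> real)"
    by (auto simp: indicator_def)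
  moreover have "(indicator (ball 0 R) :: 'a \<Rightarrow> complex) \<in> borel_measurable borel"
    by (rule borel_measurable_indicator) simp
  ultimately have "(indicator (ball 0 R) :: 'a \<Rightarrow> complex) \<in> L2"
    using emeasure_bounded_finite[of "ball (0::'a) R"] by (simp add: L2_def integrable_indicator_iff)
  from integrable_L2_mult[OF this f] show "integrable lborel (truncate_ball R f)"
    by (simp add: truncate_ball_def)
qed

lemma truncate_ball_tendsto:
  fixes f :: "'a::euclidean_space \<Rightarrow> complex"
  assumes f: "f \<in> L2"
  shows "((\<lambda>R. L2_sq (\<lambda>x. f x - truncate_ball R f x)) \<longlongrightarrow> 0) at_top"
proof (rule tendsto_at_topI_sequentially)
  fix X :: "nat \<Rightarrow> real"
  assume X: "filterlim X at_top sequentially"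
  have [measurable]: "f \<in> borel_measurable borel" using f by (simp add: L2_iff)
  have "(\<lambda>n. \<integral>\<^sup>+x. ennreal ((cmod (f x - truncate_ball (X n) f x))\<^sup>2) \<partial>lborel) \<longlonglongrightarrow> (\<integral>\<^sup>+x. (0::ennreal) \<partial>(lborel :: 'a measure))"
  proof (rule nn_integral_dominated_convergence[where w = "\<lambda>x. ennreal ((cmod (f x))\<^sup>2)"])
    show "AE x in lborel. ennreal ((cmod (f x - truncate_ball (X n) f x))\<^sup>2) \<le> ennreal ((cmod (f x))\<^sup>2)" for n
      by (auto simp: truncate_ball_def indicator_def)
    show "(\<integral>\<^sup>+x. ennreal ((cmod (f x))\<^sup>2) \<partial>lborel) < \<infinity>"
      using f by (simp add: L2_iff L2_sq_def)
    show "AE x in lborel. (\<lambda>n. ennreal ((cmod (f x - truncate_ball (X n) f x))\<^sup>2)) \<longlonglongrightarrow> 0"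
    proof (rule AE_I2)
      fix x :: 'a
      have "\<forall>\<^sub>F n in sequentially. X n > norm x"
        using X by (simp add: filterlim_at_top_dense)
      then have "\<forall>\<^sub>F n in sequentially. ennreal ((cmod (f x - truncate_ball (X n) f x))\<^sup>2) = 0"
        by eventually_elim (simp add: truncate_ball_def)
      then show "(\<lambda>n. ennreal ((cmod (f x - truncate_ball (X n) f x))\<^sup>2)) \<longlonglongrightarrow> 0"
        by (rule tendsto_eventually)
    qed
  qed measurable
  then show "(\<lambda>n. L2_sq (\<lambda>x. f x - truncate_ball (X n) f x)) \<longlonglongrightarrow> 0"
    by (simp add: L2_sq_def)
qed

lemma fourier_integral_diff:
  assumes f: "integrable lborel f" and h: "integrable lborel h"
  shows "fourier_integral (\<lambda>x. f x - h x) \<xi> = fourier_integral f \<xi> - fourier_integral h \<xi>"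
proof -
  have "integrable lborel (\<lambda>x. cis (- (x \<bullet> \<xi>)) * f x)" "integrable lborel (\<lambda>x. cis (- (x \<bullet> \<xi>)) * h x)"
    using f h by (auto intro!: integrable_unimodular)
  then show ?thesis
    by (simp add: fourier_integral_def right_diff_distrib)
qed

text \<open>By linearity and the contraction property, the transforms of the truncations are as close as
  the truncations themselves.\<close>

lemma fourier_truncate_ball_diff_le:
  fixes f :: "'a::euclidean_space \<Rightarrow> complex"
  assumes f: "f \<in> L2"
  shows "L2_sq (\<lambda>\<xi>. fourier_integral (truncate_ball R f) \<xi> - fourier_integral (truncate_ball S f) \<xi>)
     \<le> 2 * L2_sq (\<lambda>x. f x - truncate_ball R f x) + 2 * L2_sq (\<lambda>x. f x - truncate_ball S f x)"
proof -
  note t = truncate_ball_L2[OF f]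
  have "L2_sq (\<lambda>\<xi>. fourier_integral (truncate_ball R f) \<xi> - fourier_integral (truncate_ball S f) \<xi>)
      = L2_sq (fourier_integral (\<lambda>x. truncate_ball R f x - truncate_ball S f x))"
    by (simp add: fourier_integral_diff[OF t(2) t(2)] L2_sq_def)
  also have "\<dots> \<le> L2_sq (\<lambda>x. truncate_ball R f x - truncate_ball S f x)"
    by (intro fourier_integral_contraction Bochner_Integration.integrable_diff t)
  also have "\<dots> \<le> 2 * L2_sq (\<lambda>x. f x - truncate_ball R f x) + 2 * L2_sq (\<lambda>x. f x - truncate_ball S f x)"
    using t(1) f by (intro L2_sq_diff_le) (auto simp: L2_iff)
  finally show ?thesis .
qed

text \<open>Along radii for which the truncation errors decay like \<open>4\<^sup>-\<^sup>k\<close> the transforms converge almost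
  everywhere. Fatou transfers the bounds from the sequence to the limit, and with them the
  convergence to all radii \<open>S \<rightarrow> \<infinity>\<close>.\<close>

lemma has_L2_fourier_exists:
  fixes f :: "'a::euclidean_space \<Rightarrow> complex"
  assumes f: "f \<in> L2"
  obtains F where "has_L2_fourier f F" and "L2_sq F \<le> L2_sq f"
proof -
  note t = truncate_ball_L2[OF f]
  let ?e = "\<lambda>R. L2_sq (\<lambda>x. f x - truncate_ball R f x)"
  have "\<exists>R. ?e R \<le> ennreal ((1/4) ^ k)" for k :: nat
  proof -
    have ev: "\<forall>\<^sub>F R in at_top. ?e R < ennreal ((1/4) ^ k)"
      by (rule order_tendstoD(2)[OF truncate_ball_tendsto[OF f]]) simp
    obtain R where "?e R < ennreal ((1/4) ^ k)"
      using eventually_happens'[OF trivial_limit_at_top_linorder ev] by blast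
    then show ?thesis by (intro exI[of _ R]) simp
  qed
  then obtain R where R: "\<And>k::nat. ?e (R k) \<le> ennreal ((1/4) ^ k)" by metis
  define \<phi> where "\<phi> k = fourier_integral (truncate_ball (R k) f)" for k
  define F where "F x = lim (\<lambda>k. \<phi> k x)" for x
  have [measurable]: "fourier_integral (truncate_ball S f) \<in> borel_measurable borel" for S
    using t(1)[of S] by (intro fourier_integral_measurable) (simp add: L2_iff)
  have \<phi>m [measurable]: "\<phi> k \<in> borel_measurable borel" for k
    unfolding \<phi>_def by measurable
  have Fm [measurable]: "F \<in> borel_measurable borel"
    unfolding F_def by measurable
  have "AE x in lborel. convergent (\<lambda>k. \<phi> k x)"
  proof (rule AE_convergent_if_fast_Cauchy)
    fix k :: nat
    have "L2_sq (\<lambda>x. \<phi> (Suc k) x - \<phi> k x) \<le> 2 * ?e (R (Suc k)) + 2 * ?e (R k)"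
      unfolding \<phi>_def by (rule fourier_truncate_ball_diff_le[OF f])
    also have "\<dots> \<le> 2 * ennreal ((1/4) ^ k) + 2 * ennreal ((1/4) ^ k)"
    proof (intro add_mono mult_left_mono)
      show "?e (R (Suc k)) \<le> ennreal ((1/4) ^ k)"
        by (rule order_trans[OF R]) (simp add: ennreal_leI)
    qed (use R in auto)
    also have "\<dots> = ennreal (4 * (1/4) ^ k)"
      by (simp add: ennreal_mult distrib_right[symmetric])
    finally show "L2_sq (\<lambda>x. \<phi> (Suc k) x - \<phi> k x) \<le> ennreal (4 * (1/4) ^ k)" .
  qed auto
  then have lim: "AE x in lborel. (\<lambda>k. \<phi> k x) \<longlonglongrightarrow> F x"
    by eventually_elim (simp add: F_def convergent_LIMSEQ_iff)
  have "L2_sq F \<le> liminf (\<lambda>k. L2_sq (\<phi> k))"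
    by (rule L2_sq_le_liminf[OF \<phi>m lim])
  also have "\<dots> \<le> limsup (\<lambda>k. L2_sq (\<phi> k))"
    by (rule Liminf_le_Limsup) simp
  also have "\<dots> \<le> L2_sq f"
    unfolding \<phi>_def
    by (intro Limsup_bounded always_eventually allI order_trans[OF fourier_integral_contraction] t)
  finally have le: "L2_sq F \<le> L2_sq f" .
  have bd: "L2_sq (\<lambda>\<xi>. F \<xi> - fourier_integral (truncate_ball S f) \<xi>) \<le> 2 * ?e S" for S
  proof -
    have "L2_sq (\<lambda>\<xi>. F \<xi> - fourier_integral (truncate_ball S f) \<xi>)
       \<le> liminf (\<lambda>k. L2_sq (\<lambda>\<xi>. \<phi> k \<xi> - fourier_integral (truncate_ball S f) \<xi>))"
    proof (rule L2_sq_le_liminf)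
      show "AE x in lborel. (\<lambda>k. \<phi> k x - fourier_integral (truncate_ball S f) x) \<longlonglongrightarrow> F x - fourier_integral (truncate_ball S f) x"
        using lim by eventually_elim (intro tendsto_intros)
    qed measurable
    also have "\<dots> \<le> liminf (\<lambda>k. 2 * ennreal ((1/4) ^ k) + 2 * ?e S)"
    proof (intro Liminf_mono always_eventually allI)
      fix k
      have "L2_sq (\<lambda>\<xi>. \<phi> k \<xi> - fourier_integral (truncate_ball S f) \<xi>) \<le> 2 * ?e (R k) + 2 * ?e S"
        unfolding \<phi>_def by (rule fourier_truncate_ball_diff_le[OF f])
      also have "\<dots> \<le> 2 * ennreal ((1/4) ^ k) + 2 * ?e S"
        by (intro add_mono mult_left_mono R) auto
      finally show "L2_sq (\<lambda>\<xi>. \<phi> k \<xi> - fourier_integral (truncate_ball S f) \<xi>) \<le> 2 * ennreal ((1/4) ^ k) + 2 * ?e S" .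
    qed
    also have "\<dots> = 2 * ?e S"
    proof (rule lim_imp_Liminf)
      have "(\<lambda>k. 2 * ennreal ((1/4) ^ k) + 2 * ?e S) \<longlonglongrightarrow> 2 * ennreal 0 + 2 * ?e S"
        by (intro tendsto_add tendsto_const ennreal_tendsto_cmult tendsto_ennrealI LIMSEQ_power_zero) auto
      then show "(\<lambda>k. 2 * ennreal ((1/4) ^ k) + 2 * ?e S) \<longlonglongrightarrow> 2 * ?e S" by simp
    qed simp
    finally show ?thesis .
  qed
  have z: "((\<lambda>S. 2 * ?e S) \<longlongrightarrow> 2 * 0) at_top"
    by (intro ennreal_tendsto_cmult truncate_ball_tendsto f) simp
  have "((\<lambda>S. L2_sq (\<lambda>\<xi>. F \<xi> - fourier_integral (truncate_ball S f) \<xi>)) \<longlongrightarrow> 0) at_top"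
    by (rule tendsto_sandwich[OF _ _ tendsto_const z[unfolded mult_zero_right]]) (auto intro!: always_eventually bd)
  moreover have "F \<in> L2"
    using le f by (auto simp: L2_iff)
  ultimately show thesis
    using that[of F] f le by (simp add: has_L2_fourier_iff)
qed

lemma has_L2_fourier_unique:
  fixes f :: "'a::euclidean_space \<Rightarrow> complex"
  assumes F: "has_L2_fourier f F" and G: "has_L2_fourier f G"
  shows "AE \<xi> in lborel. F \<xi> = G \<xi>"
proof -
  have f: "f \<in> L2" using F by (simp add: has_L2_fourier_iff)
  note t = truncate_ball_L2[OF f]
  have [measurable]: "F \<in> borel_measurable borel" "G \<in> borel_measurable borel"
    using F G by (auto simp: has_L2_fourier_iff L2_iff)
  have [measurable]: "fourier_integral (truncate_ball S f) \<in> borel_measurable borel" for S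
    using t(1)[of S] by (intro fourier_integral_measurable) (simp add: L2_iff)
  let ?r = "\<lambda>R. 2 * L2_sq (\<lambda>\<xi>. F \<xi> - fourier_integral (truncate_ball R f) \<xi>) + 2 * L2_sq (\<lambda>\<xi>. G \<xi> - fourier_integral (truncate_ball R f) \<xi>)"
  have "(?r \<longlongrightarrow> 2 * 0 + 2 * 0) at_top"
    using F G by (intro tendsto_add ennreal_tendsto_cmult) (auto simp: has_L2_fourier_iff)
  moreover have "L2_sq (\<lambda>\<xi>. F \<xi> - G \<xi>) \<le> ?r R" for R
    using L2_sq_diff_le[of F G "fourier_integral (truncate_ball R f)"]
    by (simp add: L2_sq_minus_commute[of "fourier_integral _"])
  ultimately have "L2_sq (\<lambda>\<xi>. F \<xi> - G \<xi>) \<le> 0"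
    by (intro tendsto_lowerbound[where F=at_top and f="?r"]) (auto intro!: always_eventually)
  then show ?thesis
    by (simp add: L2_sq_eq_0_iff)
qed

text \<open>The multiplication formula with the indicator of a box, passed to the limit in the truncation
  radius.\<close>

lemma L2_pairing_box:
  fixes f :: "'a::euclidean_space \<Rightarrow> complex"
  assumes F: "has_L2_fourier f F"
  shows "(\<integral>x. F x * indicator (box a b) x \<partial>lborel) = (\<integral>x. f x * fourier_integral (indicator (box a b)) x \<partial>lborel)"
proof -
  let ?h = "indicator (box a b) :: 'a \<Rightarrow> complex"
  have f: "f \<in> L2" and F2: "F \<in> L2"
    and lim: "((\<lambda>R. L2_sq (\<lambda>\<xi>. F \<xi> - fourier_integral (truncate_ball R f) \<xi>)) \<longlongrightarrow> 0) at_top"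
    using F by (auto simp: has_L2_fourier_iff)
  note t = truncate_ball_L2[OF f]
  note h = indicator_box_L2[of a b]
  have "((\<lambda>R. \<integral>x. fourier_integral (truncate_ball R f) x * ?h x \<partial>lborel) \<longlongrightarrow> (\<integral>x. F x * ?h x \<partial>lborel)) at_top"
    by (intro L2_inner_tendsto fourier_integral_L2 t h F2 lim)
  moreover have "((\<lambda>R. \<integral>x. truncate_ball R f x * fourier_integral ?h x \<partial>lborel) \<longlongrightarrow> (\<integral>x. f x * fourier_integral ?h x \<partial>lborel)) at_top"
    by (intro L2_inner_tendsto fourier_integral_L2 t h f truncate_ball_tendsto)
  ultimately show ?thesis
    by (intro tendsto_unique[of "at_top :: real filter"]) (auto simp: fourier_integral_multiplication_formula[OF t(2) h(1)])
qed

lemma L2_sq_reflect: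
  assumes "f \<in> borel_measurable borel"
  shows "L2_sq (\<lambda>x. f (- x)) = L2_sq f"
  unfolding L2_sq_def
  by (subst (2) lborel_nn_integral_affine[where c="-1" and t=0]) (use assms in simp_all)

lemma L2_reflect: "f \<in> L2 \<Longrightarrow> (\<lambda>x. f (- x)) \<in> L2"
  using L2_sq_reflect[of f] by (auto simp: L2_iff)

lemma mem_box_reflect: "- x \<in> box a b \<longleftrightarrow> (x :: 'a::euclidean_space) \<in> box (- b) (- a)"
proof -
  have "a \<bullet> i < - (x \<bullet> i) \<and> - (x \<bullet> i) < b \<bullet> i \<longleftrightarrow> - (b \<bullet> i) < x \<bullet> i \<and> x \<bullet> i < - (a \<bullet> i)" for i
    by auto
  then show ?thesis by (simp add: box_def)
qed

text \<open>The indicator is real, so its transform is the conjugate of the transform of the reflected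
  indicator. This turns the product into the form of Parseval's identity for the truncations.\<close>

lemma L2_pairing_inverse_box:
  fixes F :: "'a::euclidean_space \<Rightarrow> complex"
  assumes F: "F \<in> L2" and w: "has_L2_fourier (\<lambda>x. F (- x)) w"
  shows "(\<integral>x. w x * fourier_integral (indicator (box a b)) x \<partial>lborel) = (\<integral>x. F x * indicator (box a b) x \<partial>lborel)"
proof -
  let ?h = "indicator (box a b) :: 'a \<Rightarrow> complex" and ?k = "indicator (box (-b) (-a)) :: 'a \<Rightarrow> complex"
  let ?f = "\<lambda>x. F (- x)"
  have f: "?f \<in> L2" and w2: "w \<in> L2"
    and lim: "((\<lambda>R. L2_sq (\<lambda>\<xi>. w \<xi> - fourier_integral (truncate_ball R ?f) \<xi>)) \<longlongrightarrow> 0) at_top"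
    using w by (auto simp: has_L2_fourier_iff)
  note t = truncate_ball_L2[OF f]
  note h = indicator_box_L2[of a b]
  have [measurable]: "F \<in> borel_measurable borel" using F by (simp add: L2_iff)
  have k: "fourier_integral ?h \<xi> = cnj (fourier_integral ?k \<xi>)" for \<xi>
  proof -
    have "(\<integral>x. cis (- (x \<bullet> \<xi>)) * ?h x \<partial>lborel) = (\<integral>x. cis (x \<bullet> \<xi>) * ?h (- x) \<partial>lborel)"
      by (subst lborel_integral_affine(2)[where c="-1" and t=0]) auto
    also have "\<dots> = (\<integral>x. cnj (cis (- (x \<bullet> \<xi>)) * ?k x) \<partial>lborel)"
    proof (intro Bochner_Integration.integral_cong refl)
      fix x
      have "?h (- x) = cnj (?k x)"
        by (simp add: indicator_def mem_box_reflect)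
      then show "cis (x \<bullet> \<xi>) * ?h (- x) = cnj (cis (- (x \<bullet> \<xi>)) * ?k x)"
        by (simp add: cis_cnj)
    qed
    also have "\<dots> = cnj (\<integral>x. cis (- (x \<bullet> \<xi>)) * ?k x \<partial>lborel)"
      by (rule Bochner_Integration.integral_cnj)
    finally show ?thesis by (simp add: fourier_integral_def)
  qed
  have "((\<lambda>R. \<integral>x. fourier_integral (truncate_ball R ?f) x * fourier_integral ?h x \<partial>lborel) \<longlongrightarrow> (\<integral>x. w x * fourier_integral ?h x \<partial>lborel)) at_top"
    by (intro L2_inner_tendsto fourier_integral_L2 t h w2 lim)
  moreover have "(\<integral>x. fourier_integral (truncate_ball R ?f) x * fourier_integral ?h x \<partial>lborel) = (\<integral>x. truncate_ball R ?f x * ?k x \<partial>lborel)" for R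
    unfolding k by (rule parseval_box[OF t(2) t(1)])
  moreover have "((\<lambda>R. \<integral>x. truncate_ball R ?f x * ?k x \<partial>lborel) \<longlongrightarrow> (\<integral>x. ?f x * ?k x \<partial>lborel)) at_top"
    by (intro L2_inner_tendsto t indicator_box_L2 f truncate_ball_tendsto)
  ultimately have "(\<integral>x. w x * fourier_integral ?h x \<partial>lborel) = (\<integral>x. ?f x * ?k x \<partial>lborel)"
    by (intro tendsto_unique[of "at_top :: real filter"]) auto
  also have "\<dots> = (\<integral>x. F x * ?k (- x) \<partial>lborel)"
    by (subst lborel_integral_affine(2)[where c="-1" and t=0]) auto
  also have "\<dots> = (\<integral>x. F x * ?h x \<partial>lborel)"
    by (simp add: indicator_def mem_box_reflect)
  finally show ?thesis .
qed

text \<open>The inverse transform is the transform composed with reflection. That it inverts is checked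
  by integrating over boxes: the two pairing lemmas both produce \<open>\<integral> w \<cdot> F1\<^sub>B\<close>.\<close>

lemma has_L2_fourier_surj:
  fixes F :: "'a::euclidean_space \<Rightarrow> complex"
  assumes F: "F \<in> L2"
  obtains w where "has_L2_fourier w F" and "L2_sq w \<le> L2_sq F"
proof -
  have Fm [measurable]: "F \<in> borel_measurable borel" using F by (simp add: L2_iff)
  obtain w where w: "has_L2_fourier (\<lambda>x. F (- x)) w" and le: "L2_sq w \<le> L2_sq (\<lambda>x. F (- x))"
    using has_L2_fourier_exists[OF L2_reflect[OF F]] .
  have w2: "w \<in> L2" using w by (simp add: has_L2_fourier_iff)
  obtain G where G: "has_L2_fourier w G"
    using has_L2_fourier_exists[OF w2] .
  have G2: "G \<in> L2" using G by (simp add: has_L2_fourier_iff)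
  then have [measurable]: "G \<in> borel_measurable borel" by (simp add: L2_iff)
  have D: "(\<lambda>x. G x - F x) \<in> L2" by (rule L2_diff[OF G2 F])
  have "AE x in lborel. G x - F x = 0"
  proof (rule AE_eq_0_if_box_integrals_0)
    fix a b :: 'a
    let ?h = "indicator (box a b) :: 'a \<Rightarrow> complex"
    show "integrable lborel (\<lambda>x. (G x - F x) * ?h x)"
      by (intro integrable_L2_mult D indicator_box_L2)
    have "(\<integral>x. (G x - F x) * ?h x \<partial>lborel) = (\<integral>x. G x * ?h x \<partial>lborel) - (\<integral>x. F x * ?h x \<partial>lborel)"
      unfolding left_diff_distrib
      by (intro Bochner_Integration.integral_diff integrable_L2_mult G2 F indicator_box_L2)
    also have "\<dots> = 0"
      by (simp add: L2_pairing_box[OF G] L2_pairing_inverse_box[OF F w])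
    finally show "(\<integral>x. (G x - F x) * ?h x \<partial>lborel) = 0" .
  qed
  then have "L2_sq (\<lambda>\<xi>. G \<xi> - fourier_integral (truncate_ball R w) \<xi>) = L2_sq (\<lambda>\<xi>. F \<xi> - fourier_integral (truncate_ball R w) \<xi>)" for R
    unfolding L2_sq_def by (intro nn_integral_cong_AE) (auto elim: eventually_mono)
  then have "has_L2_fourier w F"
    using G F by (simp add: has_L2_fourier_iff)
  then show thesis
    using that le by (simp add: L2_sq_reflect)
qed

section \<open>Energy estimates for a damped oscillator\<close>

lemma damped_oscillator_energy_le:
  fixes v v' v'' :: "real \<Rightarrow> complex" and r :: real
  assumes v: "\<And>t. t \<ge> 0 \<Longrightarrow> (v has_vector_derivative v' t) (at t within {0..})"
    and v': "\<And>t. t \<ge> 0 \<Longrightarrow> (v' has_vector_derivative v'' t) (at t within {0..})"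
    and eq: "\<And>t. t \<ge> 0 \<Longrightarrow> v'' t + of_real (r\<^sup>2) * v t + of_real (d t) * v' t = 0"
    and d: "\<And>t. t \<ge> 0 \<Longrightarrow> d t \<ge> 0" and t: "t \<ge> 0"
  shows "(cmod (v' t))\<^sup>2 + r\<^sup>2 * (cmod (v t))\<^sup>2 \<le> (cmod (v' 0))\<^sup>2 + r\<^sup>2 * (cmod (v 0))\<^sup>2"
proof -
  define E where "E s = v' s \<bullet> v' s + r\<^sup>2 * (v s \<bullet> v s)" for s
  have E: "(E has_derivative (\<lambda>h. h * (- 2 * d s * (v' s \<bullet> v' s)))) (at s within {0..t})" if s: "s \<in> {0..t}" for s
  proof -
    have v2: "v'' s = - (r\<^sup>2 *\<^sub>R v s) - d s *\<^sub>R v' s"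
      using eq[of s] s by (simp add: scaleR_conv_of_real algebra_simps eq_neg_iff_add_eq_0)
    have dv: "(v has_derivative (\<lambda>h. h *\<^sub>R v' s)) (at s within {0..t})"
      and dv': "(v' has_derivative (\<lambda>h. h *\<^sub>R v'' s)) (at s within {0..t})"
      using v[of s] v'[of s] s unfolding has_vector_derivative_def
      by (auto intro: has_derivative_subset)
    have "(E has_derivative (\<lambda>h. (v' s \<bullet> (h *\<^sub>R v'' s) + (h *\<^sub>R v'' s) \<bullet> v' s)
        + r\<^sup>2 * (v s \<bullet> (h *\<^sub>R v' s) + (h *\<^sub>R v' s) \<bullet> v s))) (at s within {0..t})"
      unfolding E_def by (intro derivative_intros dv dv')
    then show ?thesis
      by (rule has_derivative_eq_rhs)
        (simp add: fun_eq_iff v2 inner_diff_right inner_diff_left inner_commute algebra_simps)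
  qed
  \<comment> \<open>The derivative at \<open>0\<close> is one-sided, so monotonicity is read off from the mean value theorem
    relative to \<open>{0..t}\<close>.\<close>
  obtain s where s: "s \<in> {0..t}" "E t - E 0 = (t - 0) * (- 2 * d s * (v' s \<bullet> v' s))"
    using mvt_very_simple[OF t, of E "\<lambda>s h. h * (- 2 * d s * (v' s \<bullet> v' s))"] E by auto
  have "0 \<le> t * (2 * d s * (v' s \<bullet> v' s))"
    using t d[of s] s(1) by (intro mult_nonneg_nonneg) auto
  then have "E t \<le> E 0"
    using s(2) by simp
  then show ?thesis
    by (simp add: E_def power2_norm_eq_inner)
qed

lemma le_add_if_sq_le:
  fixes x a b :: real
  assumes "x\<^sup>2 \<le> a\<^sup>2 + b\<^sup>2" "a \<ge> 0" "b \<ge> 0"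
  shows "x \<le> a + b"
  using assms by (intro power2_le_imp_le[of x "a + b"]) (simp_all add: power2_sum add_increasing2)

lemma damped_oscillator_bounds:
  fixes v v' v'' :: "real \<Rightarrow> complex" and r :: real
  assumes "\<And>t. t \<ge> 0 \<Longrightarrow> (v has_vector_derivative v' t) (at t within {0..})"
    and "\<And>t. t \<ge> 0 \<Longrightarrow> (v' has_vector_derivative v'' t) (at t within {0..})"
    and "\<And>t. t \<ge> 0 \<Longrightarrow> v'' t + of_real (r\<^sup>2) * v t + of_real (d t) * v' t = 0"
    and "\<And>t. t \<ge> 0 \<Longrightarrow> d t \<ge> 0" and "t \<ge> 0" and r: "r \<ge> 0"
  shows "r * cmod (v t) \<le> r * cmod (v 0) + cmod (v' 0)"
    and "cmod (v' t) \<le> r * cmod (v 0) + cmod (v' 0)"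
proof -
  have E: "(cmod (v' t))\<^sup>2 + (r * cmod (v t))\<^sup>2 \<le> (r * cmod (v 0))\<^sup>2 + (cmod (v' 0))\<^sup>2"
    using damped_oscillator_energy_le[of v v' v'' r d t] assms by (simp add: power_mult_distrib add.commute)
  show "r * cmod (v t) \<le> r * cmod (v 0) + cmod (v' 0)"
  proof (rule le_add_if_sq_le)
    show "(r * cmod (v t))\<^sup>2 \<le> (r * cmod (v 0))\<^sup>2 + (cmod (v' 0))\<^sup>2"
      using E zero_le_power2[of "cmod (v' t)"] by linarith
  qed (use r in simp_all)
  show "cmod (v' t) \<le> r * cmod (v 0) + cmod (v' 0)"
  proof (rule le_add_if_sq_le)
    show "(cmod (v' t))\<^sup>2 \<le> (r * cmod (v 0))\<^sup>2 + (cmod (v' 0))\<^sup>2"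
      using E zero_le_power2[of "r * cmod (v t)"] by linarith
  qed (use r in simp_all)
qed

lemma powr_le_bessel_weight:
  fixes r s :: real
  assumes "r \<ge> 0" "s \<ge> 0"
  shows "r powr s \<le> (1 + r\<^sup>2) powr (s / 2)"
proof (cases "r = 0")
  case False
  then have "r powr s = (r\<^sup>2) powr (s / 2)"
    using assms by (simp add: powr_powr flip: powr_numeral)
  also have "\<dots> \<le> (1 + r\<^sup>2) powr (s / 2)"
    using assms by (intro powr_mono2) auto
  finally show ?thesis .
qed simp

text \<open>For \<open>r = 0\<close> the left-hand side vanishes, also at \<open>s = 0\<close>, because \<open>0 powr 0 = 0\<close>.\<close>

lemma homogeneous_le_bessel_weights:
  fixes r s x a b :: real
  assumes x: "x \<le> r * a + b" and r: "r \<ge> 0" and s: "s \<ge> 0" and "a \<ge> 0" "b \<ge> 0"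
  shows "r powr s * x \<le> (1 + r\<^sup>2) powr ((s + 1) / 2) * a + (1 + r\<^sup>2) powr (s / 2) * b"
proof -
  have "r powr s * x \<le> r powr s * (r * a + b)"
    by (intro mult_left_mono x) simp
  also have "\<dots> = r powr (s + 1) * a + r powr s * b"
    using powr_mult_base[OF r, of s] by (simp add: algebra_simps)
  also have "\<dots> \<le> (1 + r\<^sup>2) powr ((s + 1) / 2) * a + (1 + r\<^sup>2) powr (s / 2) * b"
    using assms by (intro add_mono mult_right_mono powr_le_bessel_weight) auto
  finally show ?thesis .
qed

section \<open>Sobolev solutions\<close>

lemma has_L2_fourier_L2_fourier:
  assumes f: "f \<in> L2"
  shows "has_L2_fourier f (L2_fourier f)"
proof -
  obtain F where "has_L2_fourier f F" using has_L2_fourier_exists[OF f] .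
  then show ?thesis
    unfolding L2_fourier_def by (rule someI[where P = "has_L2_fourier f"])
qed

lemma L2_norm_eq: "f \<in> L2 \<Longrightarrow> L2_norm f = sqrt (enn2real (L2_sq f))"
  unfolding L2_norm_def L2_sq_def by (subst integral_eq_nn_integral) (auto simp: L2_iff)

text \<open>A pointwise bound on the Fourier side yields both the existence of \<open>|D|\<^sup>a f\<close> and its norm bound:
  the multiplied transform is square-integrable and so is itself a transform. Using
  \<open>(x + y)\<^sup>2 \<le> 2 x\<^sup>2 + 2 y\<^sup>2\<close> in place of Minkowski's inequality costs a factor \<open>\<surd>2\<close>, rounded up to \<open>2\<close>.\<close>

lemma has_abs_D_exists:
  fixes f G0 G1 :: "'a::euclidean_space \<Rightarrow> complex"
  assumes f: "f \<in> L2" and G0: "G0 \<in> L2" and G1: "G1 \<in> L2"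
    and le: "AE \<xi> in lborel. norm \<xi> powr a * cmod (L2_fourier f \<xi>) \<le> cmod (G0 \<xi>) + cmod (G1 \<xi>)"
  shows "\<exists>w. has_abs_D a f w \<and> L2_norm w \<le> 2 * (L2_norm G0 + L2_norm G1)"
proof -
  define H where "H \<xi> = of_real (norm \<xi> powr a) * L2_fourier f \<xi>" for \<xi>
  have [measurable]: "L2_fourier f \<in> borel_measurable borel" "G0 \<in> borel_measurable borel" "G1 \<in> borel_measurable borel"
    using has_L2_fourier_L2_fourier[OF f] G0 G1 by (auto simp: has_L2_fourier_iff L2_iff)
  have fin: "L2_sq G0 < top" "L2_sq G1 < top"
    using G0 G1 by (auto simp: L2_iff)
  have "L2_sq H \<le> L2_sq (\<lambda>\<xi>. of_real (cmod (G0 \<xi>)) + of_real (cmod (G1 \<xi>)))"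
    unfolding L2_sq_def
  proof (rule nn_integral_mono_AE)
    show "AE \<xi> in lborel. ennreal ((cmod (H \<xi>))\<^sup>2) \<le> ennreal ((cmod (of_real (cmod (G0 \<xi>)) + of_real (cmod (G1 \<xi>))))\<^sup>2)"
      using le
    proof eventually_elim
      case (elim \<xi>)
      have "cmod (of_real (cmod (G0 \<xi>)) + of_real (cmod (G1 \<xi>))) = cmod (G0 \<xi>) + cmod (G1 \<xi>)"
        by (simp flip: of_real_add)
      with elim show ?case
        by (intro ennreal_leI power_mono) (auto simp: H_def norm_mult)
    qed
  qed
  also have "\<dots> \<le> 2 * L2_sq (\<lambda>\<xi>. of_real (cmod (G0 \<xi>))) + 2 * L2_sq (\<lambda>\<xi>. of_real (cmod (G1 \<xi>)))"
    by (rule L2_sq_add_le) measurable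
  also have "\<dots> = 2 * L2_sq G0 + 2 * L2_sq G1"
    by (simp add: L2_sq_def)
  finally have Hle: "L2_sq H \<le> 2 * L2_sq G0 + 2 * L2_sq G1" .
  have r: "2 * L2_sq G0 + 2 * L2_sq G1 = ennreal (2 * enn2real (L2_sq G0) + 2 * enn2real (L2_sq G1))"
    using fin by (simp add: ennreal_mult)
  have "H \<in> borel_measurable borel"
    unfolding H_def by measurable
  moreover have "L2_sq H < top"
    using Hle unfolding r by (rule le_less_trans) simp
  ultimately have H: "H \<in> L2"
    by (simp add: L2_iff)
  obtain w where w: "has_L2_fourier w H" and wle: "L2_sq w \<le> L2_sq H"
    using has_L2_fourier_surj[OF H] .
  have w2: "w \<in> L2" using w by (simp add: has_L2_fourier_iff)
  have "AE \<xi> in lborel. L2_fourier w \<xi> = H \<xi>"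
    by (rule has_L2_fourier_unique[OF has_L2_fourier_L2_fourier[OF w2] w])
  then have D: "has_abs_D a f w"
    using f w2 by (simp add: has_abs_D_def H_def)
  have "enn2real (L2_sq w) \<le> 2 * enn2real (L2_sq G0) + 2 * enn2real (L2_sq G1)"
    using order_trans[OF wle Hle] unfolding r by (intro enn2real_leI) auto
  also have "\<dots> \<le> (2 * (sqrt (enn2real (L2_sq G0)) + sqrt (enn2real (L2_sq G1))))\<^sup>2"
    by (simp add: power_mult_distrib power2_sum)
  finally have "L2_norm w \<le> 2 * (L2_norm G0 + L2_norm G1)"
    unfolding L2_norm_eq[OF w2] L2_norm_eq[OF G0] L2_norm_eq[OF G1]
    by (intro real_le_lsqrt) auto
  with D show ?thesis by blast
qed

text \<open>The joint representative satisfies the oscillator bounds at almost every frequency, at all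
  times at once; the transforms at the fixed time \<open>t\<close> agree with it almost everywhere.\<close>

lemma sobolev_solution_AE_bounds:
  fixes u0 u1 :: "'a::euclidean_space \<Rightarrow> complex"
  assumes sol: "sobolev_solution b g u0 u1 u ut"
    and b: "\<forall>t\<ge>0. b t \<ge> 0" and g: "\<forall>t\<ge>0. g t \<ge> 0" and t: "t \<ge> 0"
  shows "AE \<xi> in lborel. norm \<xi> * cmod (L2_fourier (u t) \<xi>)
           \<le> norm \<xi> * cmod (L2_fourier u0 \<xi>) + cmod (L2_fourier u1 \<xi>)"
    and "AE \<xi> in lborel. cmod (L2_fourier (ut t) \<xi>)
           \<le> norm \<xi> * cmod (L2_fourier u0 \<xi>) + cmod (L2_fourier u1 \<xi>)"
proof -
  obtain v v' v'' where rep: "\<forall>t\<ge>0. (AE \<xi> in lborel. v t \<xi> = L2_fourier (u t) \<xi>) \<and>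
               (AE \<xi> in lborel. v' t \<xi> = L2_fourier (ut t) \<xi>)"
    and ode: "AE \<xi> in lborel.
           v 0 \<xi> = L2_fourier u0 \<xi> \<and> v' 0 \<xi> = L2_fourier u1 \<xi> \<and>
           (\<forall>t\<ge>0.
              ((\<lambda>s. v s \<xi>) has_vector_derivative v' t \<xi>) (at t within {0..}) \<and>
              ((\<lambda>s. v' s \<xi>) has_vector_derivative v'' t \<xi>) (at t within {0..}) \<and>
              v'' t \<xi> + of_real ((norm \<xi>)\<^sup>2) * v t \<xi>
                + of_real (b t + g t * (norm \<xi>)\<^sup>2) * v' t \<xi> = 0)"
    using sol unfolding sobolev_solution_def by (elim conjE exE) (rule that; assumption)
  have rep_u: "AE \<xi> in lborel. v t \<xi> = L2_fourier (u t) \<xi>"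
    and rep_ut: "AE \<xi> in lborel. v' t \<xi> = L2_fourier (ut t) \<xi>"
    using rep t by auto
  have bounds: "AE \<xi> in lborel.
      norm \<xi> * cmod (v t \<xi>) \<le> norm \<xi> * cmod (L2_fourier u0 \<xi>) + cmod (L2_fourier u1 \<xi>) \<and>
      cmod (v' t \<xi>) \<le> norm \<xi> * cmod (L2_fourier u0 \<xi>) + cmod (L2_fourier u1 \<xi>)"
    using ode
  proof eventually_elim
    case (elim \<xi>)
    have d: "b s + g s * (norm \<xi>)\<^sup>2 \<ge> 0" if "s \<ge> 0" for s
      using b g that by simp
    note v0 = elim[THEN conjunct1] elim[THEN conjunct2, THEN conjunct1]
    note sol = elim[THEN conjunct2, THEN conjunct2, rule_format]
    note bounds = damped_oscillator_bounds[of "\<lambda>s. v s \<xi>" "\<lambda>s. v' s \<xi>" "\<lambda>s. v'' s \<xi>" "norm \<xi>"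
        "\<lambda>s. b s + g s * (norm \<xi>)\<^sup>2" t,
        OF sol[THEN conjunct1] sol[THEN conjunct2, THEN conjunct1] sol[THEN conjunct2, THEN conjunct2]
          d t norm_ge_zero]
    from bounds show ?case unfolding v0 by (intro conjI)
  qed
  show "AE \<xi> in lborel. norm \<xi> * cmod (L2_fourier (u t) \<xi>)
           \<le> norm \<xi> * cmod (L2_fourier u0 \<xi>) + cmod (L2_fourier u1 \<xi>)"
    using bounds rep_u by eventually_elim simp
  show "AE \<xi> in lborel. cmod (L2_fourier (ut t) \<xi>)
           \<le> norm \<xi> * cmod (L2_fourier u0 \<xi>) + cmod (L2_fourier u1 \<xi>)"
    using bounds rep_ut by eventually_elim simp
qed

lemma sobolev_solution_estimate:
  fixes u0 u1 :: "'a::euclidean_space \<Rightarrow> complex"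
  assumes sol: "sobolev_solution b g u0 u1 u ut"
    and b: "\<forall>t\<ge>0. b t \<ge> 0" and g: "\<forall>t\<ge>0. g t \<ge> 0" and t: "t \<ge> 0"
    and s: "s \<ge> 0" and u0: "u0 \<in> sobolev_space (s + 1)" and u1: "u1 \<in> sobolev_space s"
  shows "\<exists>w. has_abs_D (s + 1) (u t) w \<and> L2_norm w \<le> 2 * (sobolev_norm (s + 1) u0 + sobolev_norm s u1)"
    and "\<exists>w. has_abs_D s (ut t) w \<and> L2_norm w \<le> 2 * (sobolev_norm (s + 1) u0 + sobolev_norm s u1)"
proof -
  let ?G0 = "\<lambda>\<xi>. complex_of_real ((1 + (norm \<xi>)\<^sup>2) powr ((s + 1) / 2)) * L2_fourier u0 \<xi>"
  let ?G1 = "\<lambda>\<xi>. complex_of_real ((1 + (norm \<xi>)\<^sup>2) powr (s / 2)) * L2_fourier u1 \<xi>"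
  have "\<forall>t\<ge>0. u t \<in> L2 \<and> ut t \<in> L2"
    using sol unfolding sobolev_solution_def by (elim conjE)
  then have L2: "u t \<in> L2" "ut t \<in> L2"
    using t by auto
  have G: "?G0 \<in> L2" "?G1 \<in> L2"
    using u0 u1 by (simp_all add: sobolev_space_def)
  note bounds = sobolev_solution_AE_bounds[OF sol b g t]
  have "AE \<xi> in lborel. norm \<xi> powr (s + 1) * cmod (L2_fourier (u t) \<xi>) \<le> cmod (?G0 \<xi>) + cmod (?G1 \<xi>)"
    using bounds(1)
  proof eventually_elim
    case (elim \<xi>)
    have p: "norm \<xi> powr (s + 1) = norm \<xi> powr s * norm \<xi>"
      by (subst mult.commute, subst powr_mult_base) (simp_all add: add.commute)
    show ?case
      using homogeneous_le_bessel_weights[OF elim norm_ge_zero s norm_ge_zero norm_ge_zero]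
      by (simp only: p norm_mult norm_of_real abs_of_nonneg[OF powr_ge_zero] mult.assoc)
  qed
  then show "\<exists>w. has_abs_D (s + 1) (u t) w \<and> L2_norm w \<le> 2 * (sobolev_norm (s + 1) u0 + sobolev_norm s u1)"
    unfolding sobolev_norm_def by (intro has_abs_D_exists L2 G)
  have "AE \<xi> in lborel. norm \<xi> powr s * cmod (L2_fourier (ut t) \<xi>) \<le> cmod (?G0 \<xi>) + cmod (?G1 \<xi>)"
    using bounds(2)
  proof eventually_elim
    case (elim \<xi>)
    show ?case
      using homogeneous_le_bessel_weights[OF elim norm_ge_zero s norm_ge_zero norm_ge_zero]
      by (simp only: norm_mult norm_of_real abs_of_nonneg[OF powr_ge_zero])
  qed
  then show "\<exists>w. has_abs_D s (ut t) w \<and> L2_norm w \<le> 2 * (sobolev_norm (s + 1) u0 + sobolev_norm s u1)"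
    unfolding sobolev_norm_def by (intro has_abs_D_exists L2 G)
qed

theorem theorem5p2:
  fixes b g :: "real \<Rightarrow> real"
  defines "b \<equiv> \<lambda>t. exp t"
    and "g \<equiv> \<lambda>t. 1 / 2 * exp (- exp t)"
  shows "\<exists>t0\<ge>0.
    (\<forall>\<beta>::real. \<beta> \<ge> 1 \<longrightarrow> (\<exists>C>0. \<forall>(u0 :: real^'n \<Rightarrow> complex) u1 u ut.
       sobolev_solution b g u0 u1 u ut \<longrightarrow>
       u0 \<in> sobolev_space \<beta> \<longrightarrow> u1 \<in> sobolev_space (\<beta> - 1) \<longrightarrow>
       (\<forall>t\<ge>t0. \<exists>w. has_abs_D \<beta> (u t) w \<and>
          L2_norm w \<le> C * (sobolev_norm \<beta> u0 + sobolev_norm (\<beta> - 1) u1)))) \<and>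
    (\<forall>\<beta>::real. \<beta> \<ge> 0 \<longrightarrow> (\<exists>C>0. \<forall>(u0 :: real^'n \<Rightarrow> complex) u1 u ut.
       sobolev_solution b g u0 u1 u ut \<longrightarrow>
       u0 \<in> sobolev_space (\<beta> + 1) \<longrightarrow> u1 \<in> sobolev_space \<beta> \<longrightarrow>
       (\<forall>t\<ge>t0. \<exists>w. has_abs_D \<beta> (ut t) w \<and>
          L2_norm w \<le> C * (sobolev_norm (\<beta> + 1) u0 + sobolev_norm \<beta> u1))))"
proof (intro exI[of _ "0::real"] conjI)
  have b: "\<forall>t\<ge>0. b t \<ge> 0" and g: "\<forall>t\<ge>0. g t \<ge> 0"
    by (simp_all add: b_def g_def)
  show "\<forall>\<beta>::real. \<beta> \<ge> 1 \<longrightarrow> (\<exists>C>0. \<forall>(u0 :: real^'n \<Rightarrow> complex) u1 u ut.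
       sobolev_solution b g u0 u1 u ut \<longrightarrow>
       u0 \<in> sobolev_space \<beta> \<longrightarrow> u1 \<in> sobolev_space (\<beta> - 1) \<longrightarrow>
       (\<forall>t\<ge>0. \<exists>w. has_abs_D \<beta> (u t) w \<and>
          L2_norm w \<le> C * (sobolev_norm \<beta> u0 + sobolev_norm (\<beta> - 1) u1)))"
  proof (intro allI impI, rule exI[of _ 2], intro conjI allI impI)
    fix \<beta> t :: real and u0 u1 :: "real^'n \<Rightarrow> complex" and u ut
    assume "\<beta> \<ge> 1" "sobolev_solution b g u0 u1 u ut" "t \<ge> 0"
      "u0 \<in> sobolev_space \<beta>" "u1 \<in> sobolev_space (\<beta> - 1)"
    then show "\<exists>w. has_abs_D \<beta> (u t) w \<and> L2_norm w \<le> 2 * (sobolev_norm \<beta> u0 + sobolev_norm (\<beta> - 1) u1)"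
      using sobolev_solution_estimate(1)[of b g u0 u1 u ut t "\<beta> - 1"] b g by simp
  qed simp
  show "\<forall>\<beta>::real. \<beta> \<ge> 0 \<longrightarrow> (\<exists>C>0. \<forall>(u0 :: real^'n \<Rightarrow> complex) u1 u ut.
       sobolev_solution b g u0 u1 u ut \<longrightarrow>
       u0 \<in> sobolev_space (\<beta> + 1) \<longrightarrow> u1 \<in> sobolev_space \<beta> \<longrightarrow>
       (\<forall>t\<ge>0. \<exists>w. has_abs_D \<beta> (ut t) w \<and>
          L2_norm w \<le> C * (sobolev_norm (\<beta> + 1) u0 + sobolev_norm \<beta> u1)))"
  proof (intro allI impI, rule exI[of _ 2], intro conjI allI impI)
    fix \<beta> t :: real and u0 u1 :: "real^'n \<Rightarrow> complex" and u ut
    assume "\<beta> \<ge> 0" "sobolev_solution b g u0 u1 u ut" "t \<ge> 0"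
      "u0 \<in> sobolev_space (\<beta> + 1)" "u1 \<in> sobolev_space \<beta>"
    then show "\<exists>w. has_abs_D \<beta> (ut t) w \<and> L2_norm w \<le> 2 * (sobolev_norm (\<beta> + 1) u0 + sobolev_norm \<beta> u1)"
      using sobolev_solution_estimate(2)[of b g u0 u1 u ut t \<beta>] b g by simp
  qed simp
qed simp

end
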